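(* Let $q$ be a complex number with $|q|<1$, with a fixed choice of $q^{1/2}$. Let $k\ge 1$ and $1\le i\le k+1$ be integers. Then $$\sum_{n_1,\dots,n_k\ge 0} \frac{q^{N_1^2+N_2^2+\cdots+N_k^2+N_i+N_{i+1}+\cdots+N_k}}{(q;q)_{n_1}\cdots(q;q)_{n_{k-1}}(-q^{1/2};q)_{n_k}(q^2;q^2)_{n_k}} = \frac{(q^{i},q^{\frac{3}{2}+2k-i},q^{\frac{3}{2}+2k};q^{\frac{3}{2}+2k})_\infty}{(q;q)_\infty},$$ where $N_j=n_j+n_{j+1}+\cdots+n_k$ for $1\le j\le k$ and $N_j=0$ for $j>k$ (so for $i=k+1$ the linear part $N_i+\cdots+N_k$ in the exponent is $0$).
   Context: For $|q|<1$: $(a;q)_\infty=\prod_{m=0}^\infty(1-aq^m)$, $(a;q)_n=(a;q)_\infty/(aq^n;q)_\infty=\prod_{m=0}^{n-1}(1-aq^m)$ for integers $n\ge0$, and $(a_1,\dots,a_r;q)_\infty=(a_1;q)_\infty\cdots(a_r;q)_\infty$; the same notation is used with the base $q$ replaced by another power of $q$. Half-integer powers of $q$ are understood as integer powers of the fixed square root $q^{1/2}$. *)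

theory Defs
  imports "HOL-Analysis.Analysis"
begin

definition qpoch :: "complex \<Rightarrow> complex \<Rightarrow> nat \<Rightarrow> complex" where
  "qpoch a q n = (\<Prod>m<n. 1 - a * q ^ m)"

text \<open>Meaningful for \<open>norm q < 1\<close>, where the product converges in the sense of
  \<^const>\<open>convergent_prod\<close>, also when finitely many factors vanish.\<close>

definition qpoch_inf :: "complex \<Rightarrow> complex \<Rightarrow> complex" where
  "qpoch_inf a q = (\<Prod>m. 1 - a * q ^ m)"

definition tail_sum :: "nat \<Rightarrow> (nat \<Rightarrow> nat) \<Rightarrow> nat \<Rightarrow> nat" where
  "tail_sum k n j = (\<Sum>l=j..k. n l)"

text \<open>The summand at \<open>(n 1, \<dots>, n k)\<close>; \<open>s\<close> is the chosen square root of \<open>q\<close>.\<close>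

definition multisum_term :: "complex \<Rightarrow> complex \<Rightarrow> nat \<Rightarrow> nat \<Rightarrow> (nat \<Rightarrow> nat) \<Rightarrow> complex" where
  "multisum_term q s k i n =
     q ^ ((\<Sum>j=1..k. (tail_sum k n j)\<^sup>2) + (\<Sum>j=i..k. tail_sum k n j))
     / ((\<Prod>j=1..<k. qpoch q q (n j)) * qpoch (- s) q (n k) * qpoch (q\<^sup>2) (q\<^sup>2) (n k))"

end

theory Submission
  imports Defs
begin

text \<open>
  The identity is an instance of Bailey's chain, written with bilateral sums. Put
  \<open>f(a, b) r = a\<^bsup>r(r+1)/2\<^esup> b\<^bsup>r(r-1)/2\<^esup>\<close>, the general term of Ramanujan's theta
  function, and \<open>B\<^sub>d(f; N) = \<Sum>\<^sub>r f r / ((q)\<^bsub>N-r\<^esub> (q)\<^bsub>N+r+d\<^esub>)\<close> over all integers \<open>r\<close>, with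
  \<open>d \<in> {0, 1}\<close>. The q-Vandermonde sum shows that
  \<open>\<Sum>\<^sub>M q\<^bsup>M(M+d)\<^esup> B\<^sub>d(f; M) / (q)\<^bsub>N-M\<^esub>\<close> is again of this shape, with \<open>f r\<close> replaced by
  \<open>q\<^bsup>r(r+d)\<^esup> f r\<close> (\<open>bailey_sum_step\<close>). On theta terms the case \<open>d = 0\<close> sends \<open>(a, b)\<close> to
  \<open>(a q, b q)\<close>, and the case \<open>d = 1\<close> sends it to \<open>(a q\<^sup>2, b)\<close>.

  The multisum is summed from the inside outwards, one \<open>N\<^sub>j\<close> at a time, starting at \<open>j = k\<close>. The
  innermost factor \<open>1 / ((-q\<^bsup>1/2\<^esup>; q)\<^sub>n (q\<^sup>2; q\<^sup>2)\<^sub>n)\<close> is \<open>B\<^sub>0(f(-s, -s\<^sup>2); n)\<close> for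
  \<open>s = q\<^bsup>1/2\<^esup>\<close> (\<open>bailey_sum_theta_seed\<close>). A level \<open>j \<ge> i\<close> carries the weight
  \<open>q\<^bsup>N\<^sub>j\<^sup>2 + N\<^sub>j\<^esup>\<close> and is a step with \<open>d = 1\<close>; a level \<open>j < i\<close> is a step with \<open>d = 0\<close>. As long as
  the second parameter is \<open>-q\<close>, the sums \<open>B\<^sub>0\<close> and \<open>B\<^sub>1\<close> agree, because the summand of their
  difference is antisymmetric under \<open>r \<mapsto> -1-r\<close> (\<open>bailey_sum_theta_0_eq_1\<close>). The steps with \<open>d = 1\<close> come first
  and preserve that parameter, so the passage from \<open>d = 1\<close> to \<open>d = 0\<close> costs nothing.

  After all \<open>k\<close> levels the parameters are \<open>a = -s\<^bsup>4k+3-2i\<^esup>\<close> and \<open>b = -s\<^bsup>2i\<^esup>\<close>. Letting the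
  outermost bound \<open>N\<close> tend to infinity turns the left side into the multisum divided by
  \<open>(q)\<^sub>\<infinity>\<close>, and the right side into \<open>\<Sum>\<^sub>r f(a, b) r / (q)\<^sub>\<infinity>\<^sup>2\<close>. The Jacobi triple product evaluates
  the theta series. Its finite form is proved here with the same sums \<open>B\<^sub>0\<close>, in base \<open>ab\<close>.

  The parametrisation by \<open>(a, b)\<close> keeps all exponents natural numbers, so that \<open>q = 0\<close> needs no
  separate treatment.
\<close>

section \<open>Reciprocal q-factorials and the q-Vandermonde sum\<close>

text \<open>
  The argument is an integer, with value \<open>0\<close> at negative integers: this is the convention under
  which the recurrence \<open>inv_qfact_diff_1\<close> holds everywhere and the sums below need no explicit
  bounds.
\<close>
definition inv_qfact :: "complex \<Rightarrow> int \<Rightarrow> complex" where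
  "inv_qfact q m = (if m < 0 then 0 else 1 / qpoch q q (nat m))"

lemma qpoch_0 [simp]: "qpoch a q 0 = 1"
  by (simp add: qpoch_def)

lemma qpoch_Suc: "qpoch a q (Suc n) = qpoch a q n * (1 - a * q ^ n)"
  by (simp add: qpoch_def)

lemma one_minus_mult_power_nonzero:
  fixes a q :: complex
  assumes "norm a < 1" "norm q \<le> 1"
  shows "1 - a * q ^ n \<noteq> 0"
proof
  assume "1 - a * q ^ n = 0"
  hence "norm (a * q ^ n) = 1"
    by (metis eq_iff_diff_eq_0 norm_one)
  moreover have "norm (a * q ^ n) \<le> norm a * 1"
    unfolding norm_mult norm_power using assms by (intro mult_left_mono power_le_one) auto
  ultimately show False using assms by simp
qed

lemma qpoch_nonzero: "norm a < 1 \<Longrightarrow> norm q \<le> 1 \<Longrightarrow> qpoch a q n \<noteq> 0"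
  using one_minus_mult_power_nonzero by (auto simp: qpoch_def)

lemma inv_qfact_neg [simp]: "m < 0 \<Longrightarrow> inv_qfact q m = 0"
  by (simp add: inv_qfact_def)

lemma inv_qfact_0 [simp]: "inv_qfact q 0 = 1"
  by (simp add: inv_qfact_def)

lemma inv_qfact_of_nat: "inv_qfact q (int n) = 1 / qpoch q q n"
  by (simp add: inv_qfact_def)

lemma inv_qfact_diff_1:
  assumes "norm q < 1"
  shows "inv_qfact q (m - 1) = (1 - q ^ nat m) * inv_qfact q m"
proof (cases "m \<le> 0")
  case False
  then obtain n where m: "m = int (Suc n)"
    by (metis not0_implies_Suc not_le of_nat_0_le_iff of_nat_0 order_refl zero_le_imp_eq_int le_cases)
  have "m - 1 = int n" using m by simp
  thus ?thesis
    using one_minus_mult_power_nonzero[of q q n] assms qpoch_nonzero[of q q n]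
    unfolding m nat_int by (simp only: inv_qfact_of_nat) (simp add: qpoch_Suc)
qed (auto simp: inv_qfact_def)

lemma inv_qfact_diff_2:
  assumes "norm q < 1"
  shows "inv_qfact q (m - 2) = (1 - q ^ nat (m - 1)) * (1 - q ^ nat m) * inv_qfact q m"
  using inv_qfact_diff_1[OF assms, of "m - 1"] inv_qfact_diff_1[OF assms, of m] by simp

text \<open>
  This is the q-Chu-Vandermonde sum in the limiting form that counts partitions by Durfee
  rectangles. Write \<open>S n c\<close> for the left side. Pascal's rule for q-binomials splits
  \<open>(1 - q\<^bsup>n+1\<^esup>) S (n + 1) c\<close> into two sums, and the recurrence for \<open>1 / (q)\<^bsub>c+j\<^esub>\<close> recombines
  them into \<open>S n (c + 1)\<close>. The right side obeys the same relation.
\<close>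
lemma finite_q_vandermonde:
  assumes "norm q < 1"
  shows "(\<Sum>j\<le>n. q ^ (j * (j + c)) * (inv_qfact q (int n - int j) * inv_qfact q (int j)
            * inv_qfact q (int c + int j))) = inv_qfact q (int n) * inv_qfact q (int n + int c)"
proof (induction n arbitrary: c)
  case 0
  show ?case by simp
next
  case (Suc n)
  let ?I = "inv_qfact q"
  have pascal: "(1 - q ^ Suc n) * (?I (int (Suc n) - int j) * ?I (int j)) =
      q ^ j * (?I (int n - int j) * ?I (int j)) + ?I (int (Suc n) - int j) * ?I (int j - 1)"
    if "j \<le> Suc n" for j
  proof -
    have a: "?I (int n - int j) = (1 - q ^ (Suc n - j)) * ?I (int (Suc n) - int j)"
    proof -
      have "nat (int (Suc n) - int j) = Suc n - j" by linarith
      thus ?thesis using inv_qfact_diff_1[OF assms, of "int (Suc n) - int j"] by simp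
    qed
    have b: "q ^ j * q ^ (Suc n - j) = q ^ Suc n" using that
      by (metis le_add_diff_inverse power_add)
    show ?thesis unfolding a inv_qfact_diff_1[OF assms, of "int j"] nat_int b[symmetric]
      by (simp only: algebra_simps mult_1_left mult_1_right)
  qed
  let ?e = "\<lambda>c j. q ^ (j * (j + c))"
  have "(1 - q ^ Suc n) * (\<Sum>j\<le>Suc n. ?e c j * (?I (int (Suc n) - int j) * ?I (int j) * ?I (int c + int j)))
      = (\<Sum>j\<le>Suc n. ?e c j * ((1 - q ^ Suc n) * (?I (int (Suc n) - int j) * ?I (int j))) * ?I (int c + int j))"
    unfolding sum_distrib_left by (intro sum.cong refl) (simp only: mult_ac)
  also have "\<dots> = (\<Sum>j\<le>Suc n. ?e c j * q ^ j * (?I (int n - int j) * ?I (int j)) * ?I (int c + int j))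
      + (\<Sum>j\<le>Suc n. ?e c j * (?I (int (Suc n) - int j) * ?I (int j - 1)) * ?I (int c + int j))"
    unfolding sum.distrib[symmetric]
    by (intro sum.cong refl) (simp only: pascal atMost_iff, simp only: algebra_simps)
  also have "(\<Sum>j\<le>Suc n. ?e c j * q ^ j * (?I (int n - int j) * ?I (int j)) * ?I (int c + int j))
      = (\<Sum>j\<le>n. ?e c j * q ^ j * (?I (int n - int j) * ?I (int j)) * ?I (int c + int j))"
    by simp
  also have "(\<Sum>j\<le>Suc n. ?e c j * (?I (int (Suc n) - int j) * ?I (int j - 1)) * ?I (int c + int j))
      = (\<Sum>j\<le>n. ?e c (Suc j) * (?I (int n - int j) * ?I (int j)) * ?I (int c + int j + 1))"
    by (subst sum.atMost_Suc_shift) (simp add: algebra_simps)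
  also have "(\<Sum>j\<le>n. ?e c j * q ^ j * (?I (int n - int j) * ?I (int j)) * ?I (int c + int j)) + \<dots>
      = (\<Sum>j\<le>n. ?e (Suc c) j * (?I (int n - int j) * ?I (int j) * ?I (int (Suc c) + int j)))"
    unfolding sum.distrib[symmetric]
  proof (intro sum.cong refl)
    fix j
    have x: "?I (int c + int j) = (1 - q ^ (c + j + 1)) * ?I (int (Suc c) + int j)"
    proof -
      have "nat (int c + int j + 1) = c + j + 1" by simp
      thus ?thesis using inv_qfact_diff_1[OF assms, of "int c + int j + 1"]
        by (simp add: algebra_simps)
    qed
    have y: "?I (int c + int j + 1) = ?I (int (Suc c) + int j)" by (simp add: algebra_simps)
    have z: "?e c j * q ^ j = ?e (Suc c) j" "?e c (Suc j) = ?e (Suc c) j * q ^ (c + j + 1)"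
      by (simp_all flip: power_add power_Suc add: algebra_simps)
    show "?e c j * q ^ j * (?I (int n - int j) * ?I (int j)) * ?I (int c + int j)
        + ?e c (Suc j) * (?I (int n - int j) * ?I (int j)) * ?I (int c + int j + 1)
      = ?e (Suc c) j * (?I (int n - int j) * ?I (int j) * ?I (int (Suc c) + int j))"
      unfolding x y z by (simp only: algebra_simps mult_1_left mult_1_right)
  qed
  also have "\<dots> = ?I (int n) * ?I (int n + int (Suc c))" by (rule Suc.IH)
  also have "?I (int n) = (1 - q ^ Suc n) * ?I (int (Suc n))"
    using inv_qfact_diff_1[OF assms, of "int (Suc n)"] by (simp only: nat_int) simp
  also have "int n + int (Suc c) = int (Suc n) + int c" by simp
  finally show ?case
    using one_minus_mult_power_nonzero[of q q n] assms by simp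
qed

section \<open>Bilateral Bailey sums\<close>

definition bailey_kernel :: "complex \<Rightarrow> nat \<Rightarrow> nat \<Rightarrow> int \<Rightarrow> complex" where
  "bailey_kernel q d N r = inv_qfact q (int N - r) * inv_qfact q (int N + r + int d)"

text \<open>
  Only finitely many terms are nonzero. The sum is nevertheless taken over all integers, since
  shifts and reflections of the index then need no adjustment of bounds. For \<open>d = 0\<close> and \<open>d = 1\<close>
  this is, up to a constant factor, the \<open>\<beta>\<close> side of a Bailey pair relative to \<open>1\<close> and to \<open>q\<close>,
  in bilateral form.
\<close>
definition bailey_sum :: "complex \<Rightarrow> nat \<Rightarrow> (int \<Rightarrow> complex) \<Rightarrow> nat \<Rightarrow> complex" where
  "bailey_sum q d f N = (\<Sum>\<^sub>\<infinity>r. f r * bailey_kernel q d N r)"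

lemma bailey_kernel_eq_0: "r < - int N - int d \<or> int N < r \<Longrightarrow> bailey_kernel q d N r = 0"
  by (auto simp: bailey_kernel_def)

lemma bailey_summable: "(\<lambda>r. f r * bailey_kernel q d N r) summable_on UNIV"
proof (rule finite_nonzero_values_imp_summable_on)
  have "{r \<in> UNIV. f r * bailey_kernel q d N r \<noteq> 0} \<subseteq> {- int N - int d..int N}"
    using bailey_kernel_eq_0[of _ N d q] by force
  thus "finite {r \<in> UNIV. f r * bailey_kernel q d N r \<noteq> 0}"
    by (rule finite_subset) simp
qed

lemma bailey_sum_cong:
  assumes "\<And>r. - int N - int d \<le> r \<Longrightarrow> r \<le> int N \<Longrightarrow> f r = g r"
  shows "bailey_sum q d f N = bailey_sum q d g N"
  unfolding bailey_sum_def
  by (intro infsum_cong) (metis assms bailey_kernel_eq_0 mult_zero_right not_le)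

lemma bailey_sum_add:
  "bailey_sum q d (\<lambda>r. f r + g r) N = bailey_sum q d f N + bailey_sum q d g N"
  unfolding bailey_sum_def distrib_right by (intro infsum_add bailey_summable)

lemma bailey_sum_cmult: "bailey_sum q d (\<lambda>r. c * f r) N = c * bailey_sum q d f N"
  unfolding bailey_sum_def mult.assoc by (intro infsum_cmult_right bailey_summable)

lemma bailey_sum_uminus: "bailey_sum q d (\<lambda>r. - f r) N = - bailey_sum q d f N"
  using bailey_sum_cmult[of q d "-1"] by simp

lemma infsum_reflect_int: "(\<Sum>\<^sub>\<infinity>r. g (c - r)) = (\<Sum>\<^sub>\<infinity>r::int. g r)"
  by (rule infsum_reindex_bij_witness[of _ "\<lambda>r. c - r" "\<lambda>r. c - r"]) auto

lemma bailey_sum_reflect: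
  "bailey_sum q d f N = bailey_sum q d (\<lambda>r. f (- int d - r)) N"
proof -
  have k: "bailey_kernel q d N (- int d - r) = bailey_kernel q d N r" for r
    by (simp add: bailey_kernel_def algebra_simps)
  show ?thesis unfolding bailey_sum_def
    using infsum_reflect_int[of "\<lambda>r. f r * bailey_kernel q d N r" "- int d"] unfolding k by simp
qed

text \<open>
  The kernel is invariant under \<open>r \<mapsto> -d-r\<close>, so an antisymmetric coefficient sums to zero.
\<close>
lemma bailey_sum_antisymmetric:
  assumes "\<And>r. - int N - int d \<le> r \<Longrightarrow> r \<le> int N \<Longrightarrow> f (- int d - r) = - f r"
  shows "bailey_sum q d f N = 0"
proof -
  have "bailey_sum q d f N = bailey_sum q d (\<lambda>r. - f r) N"
    by (subst bailey_sum_reflect) (rule bailey_sum_cong, rule assms)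
  thus ?thesis by (simp add: bailey_sum_uminus)
qed

lemma bailey_sum_at_0: "bailey_sum q 0 f 0 = f 0"
proof -
  have "bailey_sum q 0 f 0 = (\<Sum>\<^sub>\<infinity>r\<in>{0}. f r * bailey_kernel q 0 0 r)"
    unfolding bailey_sum_def by (rule infsum_cong_neutral) (auto simp: bailey_kernel_eq_0 neq_iff)
  thus ?thesis by (simp add: bailey_kernel_def)
qed

text \<open>
  Substituting \<open>M = r + j\<close> turns this into \<open>finite_q_vandermonde\<close> with \<open>n = N - r\<close> and
  \<open>c = 2r + d\<close>.
\<close>
lemma bailey_kernel_step_nat:
  assumes q: "norm q < 1"
  shows "(\<Sum>M\<le>N. q ^ (M * M + d * M) * inv_qfact q (int N - int M) * bailey_kernel q d M (int r))
    = q ^ (r * r + d * r) * bailey_kernel q d N (int r)"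
proof (cases "r \<le> N")
  case False
  have "(\<Sum>M\<le>N. q ^ (M * M + d * M) * inv_qfact q (int N - int M) * bailey_kernel q d M (int r)) = 0"
    using False by (intro sum.neutral ballI) (simp add: bailey_kernel_eq_0)
  thus ?thesis using False by (simp add: bailey_kernel_eq_0)
next
  case True
  let ?I = "inv_qfact q"
  define n where "n = N - r"
  have N: "N = r + n" using True by (simp add: n_def)
  define c where "c = 2 * r + d"
  have "(\<Sum>M\<le>N. q ^ (M * M + d * M) * ?I (int N - int M) * bailey_kernel q d M (int r))
      = (\<Sum>M\<in>{r..N}. q ^ (M * M + d * M) * ?I (int N - int M) * bailey_kernel q d M (int r))"
    by (rule sum.mono_neutral_right) (auto simp: bailey_kernel_eq_0)
  also have "\<dots> = (\<Sum>j\<le>n. q ^ ((r + j) * (r + j) + d * (r + j)) * ?I (int N - int (r + j))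
                    * bailey_kernel q d (r + j) (int r))"
    by (rule sum.reindex_bij_witness[of _ "\<lambda>j. r + j" "\<lambda>M. M - r"]) (auto simp: N)
  also have "\<dots> = q ^ (r * r + d * r) *
      (\<Sum>j\<le>n. q ^ (j * (j + c)) * (?I (int n - int j) * ?I (int j) * ?I (int c + int j)))"
    unfolding sum_distrib_left
  proof (intro sum.cong refl)
    fix j
    have "(r + j) * (r + j) + d * (r + j) = (r * r + d * r) + j * (j + c)"
      by (simp add: c_def algebra_simps)
    hence e: "q ^ ((r + j) * (r + j) + d * (r + j)) = q ^ (r * r + d * r) * q ^ (j * (j + c))"
      by (simp only: power_add)
    have "int N - int (r + j) = int n - int j" "int (r + j) - int r = int j"
      "int (r + j) + int r + int d = int c + int j"
      by (simp_all add: N c_def)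
    thus "q ^ ((r + j) * (r + j) + d * (r + j)) * ?I (int N - int (r + j)) * bailey_kernel q d (r + j) (int r)
      = q ^ (r * r + d * r) * (q ^ (j * (j + c)) * (?I (int n - int j) * ?I (int j) * ?I (int c + int j)))"
      unfolding bailey_kernel_def e by (simp only: mult_ac)
  qed
  also have "\<dots> = q ^ (r * r + d * r) * bailey_kernel q d N (int r)"
  proof -
    have "int N - int r = int n" "int N + int r + int d = int n + int c"
      by (simp_all add: N c_def)
    thus ?thesis unfolding bailey_kernel_def finite_q_vandermonde[OF q] by simp
  qed
  finally show ?thesis .
qed

text \<open>
  Negative \<open>r\<close> follow by the reflection \<open>r \<mapsto> -d-r\<close>. It leaves no integer uncovered exactly when
  \<open>d \<le> 1\<close>.
\<close>
lemma bailey_kernel_step: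
  assumes q: "norm q < 1" and d: "d \<le> 1"
  shows "(\<Sum>M\<le>N. q ^ (M * M + d * M) * inv_qfact q (int N - int M) * bailey_kernel q d M r)
    = q ^ nat (r * r + int d * r) * bailey_kernel q d N r"
proof -
  have nonneg: "(\<Sum>M\<le>N. q ^ (M * M + d * M) * inv_qfact q (int N - int M) * bailey_kernel q d M r)
    = q ^ nat (r * r + int d * r) * bailey_kernel q d N r" if "r \<ge> 0" for r
  proof -
    obtain m where m: "r = int m" using \<open>r \<ge> 0\<close> by (metis nonneg_int_cases)
    have "nat (r * r + int d * r) = m * m + d * m"
      unfolding m by (metis nat_int of_nat_add of_nat_mult)
    thus ?thesis using bailey_kernel_step_nat[OF q, of d N m] unfolding m by simp
  qed
  show ?thesis
  proof (cases "r \<ge> 0")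
    case False
    have k: "bailey_kernel q d M (- int d - r) = bailey_kernel q d M r" for M
      by (simp add: bailey_kernel_def algebra_simps)
    have "(- int d - r) * (- int d - r) + int d * (- int d - r) = r * r + int d * r"
      by (simp add: algebra_simps)
    thus ?thesis using nonneg[of "- int d - r"] False d unfolding k by simp
  qed (rule nonneg)
qed

text \<open>
  Bailey's lemma with both free parameters sent to infinity: the kernel identity, summed against
  \<open>f\<close>.
\<close>
lemma bailey_sum_step:
  assumes q: "norm q < 1" and d: "d \<le> 1"
  shows "(\<Sum>M\<le>N. q ^ (M * M + d * M) * inv_qfact q (int N - int M) * bailey_sum q d f M)
    = bailey_sum q d (\<lambda>r. q ^ nat (r * r + int d * r) * f r) N"
proof -
  let ?c = "\<lambda>M. q ^ (M * M + d * M) * inv_qfact q (int N - int M)"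
  have s: "((\<lambda>r. ?c M * (f r * bailey_kernel q d M r)) has_sum (?c M * bailey_sum q d f M)) UNIV" for M
    unfolding bailey_sum_def by (intro has_sum_cmult_right has_sum_infsum bailey_summable)
  have swap: "((\<lambda>r. \<Sum>M\<le>K. ?c M * (f r * bailey_kernel q d M r)) has_sum
          (\<Sum>M\<le>K. ?c M * bailey_sum q d f M)) UNIV" for K
  proof (induction K)
    case 0
    show ?case using s[of 0] by (simp only: atMost_0 sum.insert_remove finite.emptyI sum.empty
        empty_Diff add_0_right)
  next
    case (Suc K)
    show ?case unfolding sum.atMost_Suc by (intro has_sum_add Suc.IH s)
  qed
  have eq: "(\<Sum>M\<le>N. ?c M * (f r * bailey_kernel q d M r))
      = q ^ nat (r * r + int d * r) * f r * bailey_kernel q d N r" for r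
  proof -
    have "(\<Sum>M\<le>N. ?c M * (f r * bailey_kernel q d M r)) = f r * (\<Sum>M\<le>N. ?c M * bailey_kernel q d M r)"
      unfolding sum_distrib_left by (intro sum.cong refl) (simp only: mult_ac)
    thus ?thesis unfolding bailey_kernel_step[OF q d] by (simp only: mult_ac)
  qed
  have "((\<lambda>r. q ^ nat (r * r + int d * r) * f r * bailey_kernel q d N r) has_sum
      (\<Sum>M\<le>N. ?c M * bailey_sum q d f M)) UNIV"
    using swap[of N] unfolding eq .
  from infsumI[OF this] show ?thesis by (simp only: bailey_sum_def)
qed

text \<open>
  For \<open>d = 0\<close> the kernel is \<open>1 / (w)\<^bsub>2n\<^esub>\<close> times the q-binomial of \<open>2n\<close> over \<open>n + r\<close>. This is
  Pascal's rule applied twice, passing from \<open>2n\<close> to \<open>2n + 2\<close>.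
\<close>
lemma bailey_kernel_Suc:
  assumes w: "norm w < 1"
  shows "(1 - w ^ (2 * n + 1)) * (1 - w ^ (2 * n + 2)) * bailey_kernel w 0 (Suc n) r
    = (1 + w ^ (2 * n + 1)) * bailey_kernel w 0 n r
      + w ^ nat (int n + 1 - r) * bailey_kernel w 0 n (r - 1)
      + w ^ nat (int n + 1 + r) * bailey_kernel w 0 n (r + 1)"
proof (cases "\<bar>r\<bar> \<le> int n + 1")
  case False
  thus ?thesis by (auto simp: bailey_kernel_eq_0 abs_le_iff)
next
  case True
  let ?I = "inv_qfact w"
  define x where "x = nat (int n + 1 - r)"
  define y where "y = nat (int n + 1 + r)"
  have X: "int n + 1 - r = int x" and Y: "int n + 1 + r = int y" using True by (auto simp: x_def y_def)
  have xy: "x + y = 2 * n + 2" using X Y by linarith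
  have k: "bailey_kernel w 0 (Suc n) r = ?I (int x) * ?I (int y)"
    "bailey_kernel w 0 n r = ?I (int x - 1) * ?I (int y - 1)"
    "bailey_kernel w 0 n (r - 1) = ?I (int x) * ?I (int y - 2)"
    "bailey_kernel w 0 n (r + 1) = ?I (int x - 2) * ?I (int y)"
    unfolding bailey_kernel_def X[symmetric] Y[symmetric] by (simp_all add: algebra_simps)
  have nt: "nat (int m - 1) = m - 1" for m by simp
  have factors: "(1 - w ^ (2 * n + 1)) * (1 - w ^ (2 * n + 2)) =
    (1 + w ^ (2 * n + 1)) * ((1 - w ^ x) * (1 - w ^ y))
     + w ^ x * ((1 - w ^ (y - 1)) * (1 - w ^ y)) + w ^ y * ((1 - w ^ (x - 1)) * (1 - w ^ x))"
  proof (cases "x = 0 \<or> y = 0")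
    case True
    with xy have "x = 0 \<and> y = 2 * n + 2 \<or> y = 0 \<and> x = 2 * n + 2" by auto
    thus ?thesis by (auto simp: algebra_simps)
  next
    case False
    then obtain x' y' where s: "x = Suc x'" "y = Suc y'" by (metis not0_implies_Suc)
    have "2 * n = x' + y'" using xy unfolding s by simp
    thus ?thesis unfolding s by (simp add: algebra_simps power_add)
  qed
  show ?thesis unfolding k X Y nat_int inv_qfact_diff_1[OF w] inv_qfact_diff_2[OF w] nt factors
    by (simp only: distrib_left distrib_right mult_ac)
qed

text \<open>
  Pascal's rule, transposed onto the coefficients. It gives recurrences in \<open>n\<close> for both the
  finite Jacobi triple product and the seed of the chain.
\<close>
lemma bailey_sum_Suc:
  assumes w: "norm w < 1"
  shows "(1 - w ^ (2 * n + 1)) * (1 - w ^ (2 * n + 2)) * bailey_sum w 0 f (Suc n)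
    = bailey_sum w 0 (\<lambda>r. (1 + w ^ (2 * n + 1)) * f r
        + w ^ nat (int n - r) * f (r + 1) + w ^ nat (int n + r) * f (r - 1)) n"
proof -
  let ?K = "bailey_kernel w 0 n"
  let ?g = "\<lambda>r. w ^ nat (int n - r) * f (r + 1)" and ?h = "\<lambda>r. w ^ nat (int n + r) * f (r - 1)"
  have g: "((\<lambda>r. ?g (r - 1) * ?K (r - 1)) has_sum bailey_sum w 0 ?g n) UNIV"
    unfolding bailey_sum_def
    by (rule has_sum_reindex_bij_witness[of _ "\<lambda>r. r + 1" "\<lambda>r. r - 1", THEN iffD2,
          OF _ _ _ _ _ _ has_sum_infsum[OF bailey_summable]]) auto
  have h: "((\<lambda>r. ?h (r + 1) * ?K (r + 1)) has_sum bailey_sum w 0 ?h n) UNIV"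
    unfolding bailey_sum_def
    by (rule has_sum_reindex_bij_witness[of _ "\<lambda>r. r - 1" "\<lambda>r. r + 1", THEN iffD2,
          OF _ _ _ _ _ _ has_sum_infsum[OF bailey_summable]]) auto
  have "((\<lambda>r. (1 + w ^ (2 * n + 1)) * f r * ?K r + ?g (r - 1) * ?K (r - 1) + ?h (r + 1) * ?K (r + 1))
    has_sum (bailey_sum w 0 (\<lambda>r. (1 + w ^ (2 * n + 1)) * f r) n
      + bailey_sum w 0 ?g n + bailey_sum w 0 ?h n)) UNIV"
    by (intro has_sum_add g h) (simp_all only: bailey_sum_def has_sum_infsum bailey_summable)
  moreover have "(1 + w ^ (2 * n + 1)) * f r * ?K r + ?g (r - 1) * ?K (r - 1) + ?h (r + 1) * ?K (r + 1)
      = (1 - w ^ (2 * n + 1)) * (1 - w ^ (2 * n + 2)) * f r * bailey_kernel w 0 (Suc n) r" for r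
  proof -
    have "int n - (r - 1) = int n + 1 - r" "int n + (r + 1) = int n + 1 + r"
      "r - 1 + 1 = r" "r + 1 - 1 = r" by simp_all
    hence "?thesis \<longleftrightarrow> f r * ((1 + w ^ (2 * n + 1)) * ?K r
        + w ^ nat (int n + 1 - r) * ?K (r - 1) + w ^ nat (int n + 1 + r) * ?K (r + 1))
      = (1 - w ^ (2 * n + 1)) * (1 - w ^ (2 * n + 2)) * f r * bailey_kernel w 0 (Suc n) r"
      by (simp only: distrib_left mult_ac)
    thus ?thesis unfolding bailey_kernel_Suc[OF w, of n r, symmetric] by (simp only: mult_ac)
  qed
  ultimately show ?thesis
    unfolding bailey_sum_add bailey_sum_cmult[symmetric] by (simp add: bailey_sum_def infsumI)
qed

section \<open>Theta terms\<close>

definition tri :: "int \<Rightarrow> nat" where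
  "tri r = nat (r * (r + 1) div 2)"

text \<open>
  The general term of Ramanujan's theta function \<open>f(a, b)\<close>. The sign \<open>(-1)\<^sup>r\<close> of the classical
  series is absorbed by negative \<open>a\<close> and \<open>b\<close>, since \<open>r(r+1)/2 + r(r-1)/2 = r\<^sup>2\<close>.
\<close>
definition theta_term :: "complex \<Rightarrow> complex \<Rightarrow> int \<Rightarrow> complex" where
  "theta_term a b r = a ^ tri r * b ^ tri (r - 1)"

lemma double_tri: "2 * int (tri r) = r * (r + 1)"
proof -
  have "r * (r + 1) \<ge> 0"
    by (cases "r \<ge> 0") (auto intro: mult_nonneg_nonneg mult_nonpos_nonpos)
  moreover have "even (r * (r + 1))" by simp
  ultimately show ?thesis unfolding tri_def by (simp add: pos_imp_zdiv_nonneg_iff)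
qed

lemma tri_add_1: "int (tri (r + 1)) = int (tri r) + r + 1"
  using double_tri[of r] double_tri[of "r + 1"] by (simp add: algebra_simps)

lemma tri_diff_1: "int (tri (r - 1)) = int (tri r) - r"
  using tri_add_1[of "r - 1"] by simp

lemma tri_diff_2: "int (tri (r - 2)) = int (tri r) - 2 * r + 1"
  using tri_diff_1[of "r - 1"] tri_diff_1[of r] by simp

lemma tri_add_tri_diff_1: "tri r + tri (r - 1) = nat (r * r)"
proof -
  have "int (tri r + tri (r - 1)) = r * r"
    using double_tri[of r] tri_diff_1[of r] by (simp add: algebra_simps)
  thus ?thesis by (metis nat_int)
qed

lemma tri_reflect: "tri (- 1 - r) = tri r"
  using double_tri[of r] double_tri[of "- 1 - r"] by (simp add: algebra_simps)

lemma tri_uminus: "tri (- r) = tri (r - 1)"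
  using tri_reflect[of "r - 1"] by simp

lemma tri_reflect_diff_1: "tri (- 1 - r - 1) = tri (r + 1)"
  using tri_reflect[of "r + 1"] by (simp add: algebra_simps)

lemma minus_one_power_tri: "(-1) ^ tri (r + 1) = - ((-1) ^ tri (r - 1) :: complex)"
proof -
  have "int (tri (r + 1)) = int (tri (r - 1)) + 2 * r + 1"
    using tri_add_1[of r] tri_diff_1[of r] by linarith
  hence "even (tri (r + 1)) \<longleftrightarrow> odd (tri (r - 1))" by presburger
  thus ?thesis by (auto simp: minus_one_power_iff)
qed

lemma theta_term_commute: "theta_term a b (- r) = theta_term b a r"
proof -
  have "- r - 1 = - 1 - r" by simp
  thus ?thesis by (simp only: theta_term_def tri_uminus tri_reflect mult.commute)
qed

text \<open>
  The ratio of consecutive theta terms is \<open>a (a b)\<^sup>r\<close>. Multiplying by a power of \<open>a b\<close> that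
  covers all negative \<open>r\<close> in question avoids a division.
\<close>
lemma theta_term_add_1:
  assumes "r \<le> int n"
  shows "(a * b) ^ nat (int n - r) * theta_term a b (r + 1) = a * (a * b) ^ n * theta_term a b r"
proof -
  have A: "nat (int n - r) + tri (r + 1) = 1 + n + tri r"
    using assms tri_add_1[of r] by linarith
  have B: "nat (int n - r) + tri r = n + tri (r - 1)"
    using assms tri_diff_1[of r] by linarith
  have "(a * b) ^ nat (int n - r) * theta_term a b (r + 1)
      = a ^ (nat (int n - r) + tri (r + 1)) * b ^ (nat (int n - r) + tri r)"
    by (simp add: theta_term_def power_add power_mult_distrib)
  also have "\<dots> = a * (a * b) ^ n * theta_term a b r"
    unfolding A B by (simp add: theta_term_def power_add power_mult_distrib)
  finally show ?thesis .
qed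

lemma theta_term_diff_1:
  assumes "- int n \<le> r"
  shows "(a * b) ^ nat (int n + r) * theta_term a b (r - 1) = b * (a * b) ^ n * theta_term a b r"
  using theta_term_add_1[of "- r" n b a] assms theta_term_commute[of b a r]
    theta_term_commute[of b a "r - 1"] by (simp add: mult.commute)

section \<open>The finite Jacobi triple product\<close>

text \<open>
  In base \<open>w = a b\<close> the three coefficients produced by \<open>bailey_sum_Suc\<close> are
  \<open>1 + w\<^bsup>2n+1\<^esup>\<close>, \<open>a w\<^sup>n\<close> and \<open>b w\<^sup>n\<close> times the same theta term. They add up to the product
  \<open>(1 + a w\<^sup>n) (1 + b w\<^sup>n)\<close>.
\<close>
lemma bailey_sum_theta_product:
  assumes w: "norm (a * b) < 1"
  shows "bailey_sum (a * b) 0 (theta_term a b) n * qpoch (a * b) (a * b) (2 * n)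
    = qpoch (- a) (a * b) n * qpoch (- b) (a * b) n"
proof (induction n)
  case 0
  show ?case by (simp add: bailey_sum_at_0 theta_term_def tri_def)
next
  case (Suc n)
  let ?w = "a * b"
  have "(1 - ?w ^ (2 * n + 1)) * (1 - ?w ^ (2 * n + 2)) * bailey_sum ?w 0 (theta_term a b) (Suc n)
      = bailey_sum ?w 0 (\<lambda>r. ((1 + a * ?w ^ n) * (1 + b * ?w ^ n)) * theta_term a b r) n"
    unfolding bailey_sum_Suc[OF w]
  proof (rule bailey_sum_cong)
    fix r assume r: "- int n - int 0 \<le> r" "r \<le> int n"
    have e: "?w ^ (2 * n + 1) = (a * ?w ^ n) * (b * ?w ^ n)"
      by (simp add: mult_2 power_add)
    show "(1 + ?w ^ (2 * n + 1)) * theta_term a b r + ?w ^ nat (int n - r) * theta_term a b (r + 1)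
        + ?w ^ nat (int n + r) * theta_term a b (r - 1)
      = ((1 + a * ?w ^ n) * (1 + b * ?w ^ n)) * theta_term a b r"
      using theta_term_add_1[of r n a b] theta_term_diff_1[of n r a b] r
      unfolding e by (simp add: algebra_simps)
  qed
  also have "\<dots> = (1 + a * ?w ^ n) * (1 + b * ?w ^ n) * bailey_sum ?w 0 (theta_term a b) n"
    by (rule bailey_sum_cmult)
  finally have rec: "(1 - ?w ^ (2 * n + 1)) * (1 - ?w ^ (2 * n + 2)) * bailey_sum ?w 0 (theta_term a b) (Suc n)
    = (1 + a * ?w ^ n) * (1 + b * ?w ^ n) * bailey_sum ?w 0 (theta_term a b) n" .
  have "qpoch ?w ?w (2 * Suc n) = qpoch ?w ?w (2 * n) * ((1 - ?w ^ (2 * n + 1)) * (1 - ?w ^ (2 * n + 2)))"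
    by (simp add: qpoch_Suc)
  hence "bailey_sum ?w 0 (theta_term a b) (Suc n) * qpoch ?w ?w (2 * Suc n)
    = qpoch ?w ?w (2 * n) * ((1 - ?w ^ (2 * n + 1)) * (1 - ?w ^ (2 * n + 2)) * bailey_sum ?w 0 (theta_term a b) (Suc n))"
    by (simp only: mult_ac)
  also have "\<dots> = (bailey_sum ?w 0 (theta_term a b) n * qpoch ?w ?w (2 * n)) * ((1 + a * ?w ^ n) * (1 + b * ?w ^ n))"
    unfolding rec by (simp only: mult_ac)
  also have "\<dots> = qpoch (- a) ?w (Suc n) * qpoch (- b) ?w (Suc n)"
    unfolding Suc.IH by (simp add: qpoch_Suc mult_ac)
  finally show ?case .
qed

section \<open>The seed of the chain\<close>

lemma bailey_kernel_0_conv_1: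
  assumes "norm q < 1"
  shows "bailey_kernel q 0 N r = (1 - q ^ nat (int N + r + 1)) * bailey_kernel q 1 N r"
  using inv_qfact_diff_1[OF assms, of "int N + r + 1"] by (simp add: bailey_kernel_def mult_ac)

lemma bailey_sum_0_conv_1:
  assumes "norm q < 1"
  shows "bailey_sum q 0 f N =
    bailey_sum q 1 f N + bailey_sum q 1 (\<lambda>r. - (q ^ nat (int N + r + 1) * f r)) N"
proof -
  have "bailey_sum q 0 f N = bailey_sum q 1 (\<lambda>r. f r + - (q ^ nat (int N + r + 1) * f r)) N"
    unfolding bailey_sum_def bailey_kernel_0_conv_1[OF assms] by (simp add: algebra_simps)
  thus ?thesis by (simp only: bailey_sum_add)
qed

text \<open>
  The difference of the two sums has coefficient \<open>q\<^bsup>N+r+1\<^esup> f(a, -q) r\<close> against the kernel with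
  \<open>d = 1\<close>. Up to the factor \<open>q\<^bsup>N+1\<^esup>\<close> this is \<open>a\<^bsup>r(r+1)/2\<^esup> q\<^bsup>r(r+1)/2\<^esup>\<close> with the sign
  \<open>(-1)\<^bsup>r(r-1)/2\<^esup>\<close>, and that sign alone changes under \<open>r \<mapsto> -1-r\<close>.
\<close>
lemma bailey_sum_theta_0_eq_1:
  assumes q: "norm q < 1"
  shows "bailey_sum q 0 (theta_term a (- q)) N = bailey_sum q 1 (theta_term a (- q)) N"
proof -
  have "bailey_sum q 1 (\<lambda>r. q ^ nat (int N + r + 1) * theta_term a (- q) r) N = 0"
  proof (rule bailey_sum_antisymmetric)
    fix r assume r: "- int N - int 1 \<le> r" "r \<le> int N"
    have 1: "tri (- int 1 - r) = tri r" and 2: "tri (- int 1 - r - 1) = tri (r + 1)"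
      using tri_reflect tri_reflect_diff_1 by simp_all
    have e: "tri (r + 1) + nat (int N + (- int 1 - r) + 1) = tri (r - 1) + nat (int N + r + 1)"
      using r tri_add_1[of r] tri_diff_1[of r] by linarith
    have "q ^ nat (int N + (- int 1 - r) + 1) * theta_term a (- q) (- int 1 - r)
        = (-1) ^ tri (r + 1) * a ^ tri r * q ^ (tri (r + 1) + nat (int N + (- int 1 - r) + 1))"
      unfolding theta_term_def 1 2 power_add power_minus[of q] by (simp only: mult_ac)
    also have "\<dots> = - (q ^ nat (int N + r + 1) * theta_term a (- q) r)"
      unfolding minus_one_power_tri e theta_term_def power_add power_minus[of q] by simp
    finally show "q ^ nat (int N + (- int 1 - r) + 1) * theta_term a (- q) (- int 1 - r)
        = - (q ^ nat (int N + r + 1) * theta_term a (- q) r)" .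
  qed
  thus ?thesis unfolding bailey_sum_0_conv_1[OF q, of _ N] by (simp add: bailey_sum_uminus)
qed

lemma power_minus_square: "(- (s\<^sup>2 :: complex)) ^ n = (-1) ^ n * s ^ (2 * n)"
  by (simp add: power_minus[of "s\<^sup>2"] power_mult)

text \<open>
  A companion evaluation that closes the recurrence for the seed. The coefficient
  \<open>f(-s\<^sup>3, -1)\<close> is antisymmetric, so it contributes nothing against the kernel with \<open>d = 1\<close>; what
  remains of the kernel with \<open>d = 0\<close> is the seed sum, reflected and scaled by \<open>s\<^bsup>2n\<^esup>\<close>.
\<close>
lemma bailey_sum_theta_cubic:
  assumes s: "norm (s\<^sup>2) < 1"
  shows "bailey_sum (s\<^sup>2) 0 (theta_term (- (s ^ 3)) (- 1)) n
    = s ^ (2 * n) * bailey_sum (s\<^sup>2) 0 (theta_term (- s) (- (s\<^sup>2))) n"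
proof -
  let ?k = "theta_term (- (s ^ 3)) (- 1)" and ?t = "theta_term (- s) (- (s\<^sup>2))"
  have "bailey_sum (s\<^sup>2) 1 ?k n = 0"
  proof (rule bailey_sum_antisymmetric)
    fix r
    have 1: "tri (- int 1 - r) = tri r" and 2: "tri (- int 1 - r - 1) = tri (r + 1)"
      using tri_reflect tri_reflect_diff_1 by simp_all
    show "?k (- int 1 - r) = - ?k r" by (simp only: theta_term_def 1 2 minus_one_power_tri) simp
  qed
  moreover have "bailey_sum (s\<^sup>2) 1 (\<lambda>r. - ((s\<^sup>2) ^ nat (int n + r + 1) * ?k r)) n
      = s ^ (2 * n) * bailey_sum (s\<^sup>2) 1 ?t n"
  proof -
    have "bailey_sum (s\<^sup>2) 1 (\<lambda>r. - ((s\<^sup>2) ^ nat (int n + r + 1) * ?k r)) n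
      = bailey_sum (s\<^sup>2) 1 (\<lambda>r. s ^ (2 * n) * ?t (- int 1 - r)) n"
    proof (rule bailey_sum_cong)
      fix r assume r: "- int n - int 1 \<le> r" "r \<le> int n"
      have 1: "tri (- int 1 - r) = tri r" and 2: "tri (- int 1 - r - 1) = tri (r + 1)"
        using tri_reflect tri_reflect_diff_1 by simp_all
      have e: "2 * nat (int n + r + 1) + 3 * tri r = 2 * n + (tri r + 2 * tri (r + 1))"
        using r tri_add_1[of r] by linarith
      have "- ((s\<^sup>2) ^ nat (int n + r + 1) * ?k r)
         = - ((-1) ^ tri r * (-1) ^ tri (r - 1)) * s ^ (2 * nat (int n + r + 1) + 3 * tri r)"
        unfolding theta_term_def power_minus[of "s ^ 3"] power_add by (simp flip: power_mult)
      also have "\<dots> = s ^ (2 * n) * ((-1) ^ tri r * (-1) ^ tri (r + 1) * s ^ (tri r + 2 * tri (r + 1)))"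
        unfolding e minus_one_power_tri power_add by (simp add: mult_ac)
      also have "\<dots> = s ^ (2 * n) * ?t (- int 1 - r)"
        unfolding theta_term_def 1 2 power_minus_square power_minus[of s] power_add by (simp add: mult_ac)
      finally show "- ((s\<^sup>2) ^ nat (int n + r + 1) * ?k r) = s ^ (2 * n) * ?t (- int 1 - r)" .
    qed
    also have "\<dots> = s ^ (2 * n) * bailey_sum (s\<^sup>2) 1 ?t n"
      unfolding bailey_sum_cmult using bailey_sum_reflect[of "s\<^sup>2" 1 ?t n] by simp
    finally show ?thesis .
  qed
  ultimately show ?thesis
    unfolding bailey_sum_0_conv_1[OF s, of ?k] bailey_sum_theta_0_eq_1[OF s] by simp
qed

text \<open>
  The two sides satisfy the same first-order recurrence in \<open>n\<close>. Let \<open>U n\<close> be the left side. In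
  \<open>bailey_sum_Suc\<close> the shifted terms \<open>f(r + 1)\<close> and \<open>f(r - 1)\<close> become multiples of \<open>f(-s\<^sup>2, -s) r\<close>
  and \<open>f(-1, -s\<^sup>3) r\<close>. The first sums to \<open>U n\<close> by reflection, and the second to
  \<open>s\<^bsup>2n\<^esup> U n\<close> by \<open>bailey_sum_theta_cubic\<close>. Altogether
  \<open>(1 - q\<^bsup>2n+1\<^esup>) (1 - q\<^bsup>2n+2\<^esup>) U (n + 1) = (1 - s\<^bsup>2n+1\<^esup>) U n\<close>.
\<close>
lemma bailey_sum_theta_seed:
  assumes s: "norm (s\<^sup>2) < 1"
  shows "bailey_sum (s\<^sup>2) 0 (theta_term (- s) (- (s\<^sup>2))) n
    = 1 / (qpoch (- s) (s\<^sup>2) n * qpoch ((s\<^sup>2)\<^sup>2) ((s\<^sup>2)\<^sup>2) n)"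
proof (induction n)
  case 0
  show ?case by (simp add: bailey_sum_at_0 theta_term_def tri_def)
next
  case (Suc n)
  let ?q = "s\<^sup>2"
  let ?t = "theta_term (- s) (- ?q)"
  let ?U = "bailey_sum ?q 0 ?t"
  let ?x = "s ^ (2 * n + 1)"
  have "(1 - ?q ^ (2 * n + 1)) * (1 - ?q ^ (2 * n + 2)) * ?U (Suc n)
      = bailey_sum ?q 0 (\<lambda>r. (1 + ?q ^ (2 * n + 1)) * ?t r + - ?x * ?t (- r)
          + - (s ^ (2 * n + 2)) * theta_term (- (s ^ 3)) (- 1) (- r)) n"
    unfolding bailey_sum_Suc[OF s]
  proof (rule bailey_sum_cong)
    fix r assume r: "- int n - int 0 \<le> r" "r \<le> int n"
    have e1: "2 * nat (int n - r) + (tri (r + 1) + 2 * tri r) = 2 * n + 1 + (2 * tri r + tri (r - 1))"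
      using r tri_add_1[of r] tri_diff_1[of r] by linarith
    have e2: "2 * nat (int n + r) + (tri (r - 1) + 2 * tri (r - 2)) = 2 * n + 2 + 3 * tri (r - 1)"
      using r tri_diff_1[of r] tri_diff_2[of r] by linarith
    have par: "(-1) ^ tri (r - 2) = - ((-1) ^ tri r :: complex)"
      using minus_one_power_tri[of "r - 1"] by simp
    have s1: "r + 1 - 1 = r" "r - 1 - 1 = r - 2" by simp_all
    have "?q ^ nat (int n - r) * ?t (r + 1)
       = (-1) ^ tri (r + 1) * (-1) ^ tri r * s ^ (2 * nat (int n - r) + (tri (r + 1) + 2 * tri r))"
      unfolding theta_term_def s1 power_minus_square power_minus[of s] power_add
      by (simp add: power_mult mult_ac)
    also have "\<dots> = - ?x * theta_term (- ?q) (- s) r"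
      unfolding e1 minus_one_power_tri theta_term_def power_minus_square power_minus[of s] power_add by simp
    finally have 1: "?q ^ nat (int n - r) * ?t (r + 1) = - ?x * ?t (- r)"
      by (simp only: theta_term_commute)
    have "?q ^ nat (int n + r) * ?t (r - 1)
       = (-1) ^ tri (r - 1) * (-1) ^ tri (r - 2) * s ^ (2 * nat (int n + r) + (tri (r - 1) + 2 * tri (r - 2)))"
      unfolding theta_term_def s1 power_minus_square power_minus[of s] power_add
      by (simp add: power_mult mult_ac)
    also have "\<dots> = - (s ^ (2 * n + 2)) * theta_term (- 1) (- (s ^ 3)) r"
      unfolding e2 par theta_term_def power_minus[of "s ^ 3"] power_add by (simp flip: power_mult)
    finally have 2: "?q ^ nat (int n + r) * ?t (r - 1) = - (s ^ (2 * n + 2)) * theta_term (- (s ^ 3)) (- 1) (- r)"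
      by (simp only: theta_term_commute)
    show "(1 + ?q ^ (2 * n + 1)) * ?t r + ?q ^ nat (int n - r) * ?t (r + 1) + ?q ^ nat (int n + r) * ?t (r - 1)
      = (1 + ?q ^ (2 * n + 1)) * ?t r + - ?x * ?t (- r)
          + - (s ^ (2 * n + 2)) * theta_term (- (s ^ 3)) (- 1) (- r)"
      unfolding 1 2 ..
  qed
  also have "\<dots> = (1 + ?q ^ (2 * n + 1)) * ?U n + - ?x * ?U n + - (s ^ (2 * n + 2)) * (s ^ (2 * n) * ?U n)"
    unfolding bailey_sum_add bailey_sum_cmult bailey_sum_theta_cubic[OF s, symmetric]
    using bailey_sum_reflect[of ?q 0 ?t n] bailey_sum_reflect[of ?q 0 "theta_term (- (s ^ 3)) (- 1)" n] by simp
  also have "\<dots> = (1 - ?x) * ?U n"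
  proof -
    have "?q ^ (2 * n + 1) = s ^ (2 * n + 2) * s ^ (2 * n)"
      by (simp flip: power_mult power_add)
    thus ?thesis by (simp only: algebra_simps mult_1_left mult_1_right) simp
  qed
  finally have rec: "(1 - ?q ^ (2 * n + 1)) * (1 - ?q ^ (2 * n + 2)) * ?U (Suc n) = (1 - ?x) * ?U n" .
  have ns: "norm s < 1" using s by (simp add: norm_power power_less_one_iff abs_square_less_1)
  \<comment> \<open>The factor \<open>1 - s\<^bsup>2n+1\<^esup>\<close> cancels against \<open>1 - q\<^bsup>2n+1\<^esup> = (1 - s\<^bsup>2n+1\<^esup>) (1 + s\<^bsup>2n+1\<^esup>)\<close>.\<close>
  have nz: "1 - ?x \<noteq> 0" using one_minus_mult_power_nonzero[of s s "2 * n"] ns by simp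
  have nz2: "1 + ?x \<noteq> 0" using one_minus_mult_power_nonzero[of "- s" s "2 * n"] ns by simp
  have nz3: "1 - ?q ^ (2 * n + 2) \<noteq> 0"
    using one_minus_mult_power_nonzero[of ?q ?q "2 * n + 1"] s by simp
  have "?q ^ (2 * n + 1) = ?x * ?x" by (simp flip: power_mult power_add)
  hence "1 - ?q ^ (2 * n + 1) = (1 - ?x) * (1 + ?x)" by (simp add: algebra_simps)
  hence "(1 - ?x) * ((1 + ?x) * (1 - ?q ^ (2 * n + 2)) * ?U (Suc n)) = (1 - ?x) * ?U n"
    using rec by (simp only: mult_ac)
  hence "(1 + ?x) * (1 - ?q ^ (2 * n + 2)) * ?U (Suc n) = ?U n" using nz by simp
  hence "?U (Suc n) = ?U n / ((1 + ?x) * (1 - ?q ^ (2 * n + 2)))"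
    using nz2 nz3 by (subst nonzero_eq_divide_eq) (simp_all only: mult_ac mult_eq_0_iff simp_thms)
  moreover have "qpoch (- s) ?q (Suc n) = qpoch (- s) ?q n * (1 + ?x)"
    by (simp add: qpoch_Suc power_mult)
  moreover have "qpoch (?q\<^sup>2) (?q\<^sup>2) (Suc n) = qpoch (?q\<^sup>2) (?q\<^sup>2) n * (1 - ?q ^ (2 * n + 2))"
  proof -
    have "2 * n + 2 = 2 * Suc n" by simp
    hence "?q ^ (2 * n + 2) = ?q\<^sup>2 * (?q\<^sup>2) ^ n" by (simp only: power_mult power_Suc)
    thus ?thesis by (simp only: qpoch_Suc)
  qed
  ultimately show ?case unfolding Suc.IH by (simp add: mult_ac)
qed

section \<open>Limits and the Jacobi triple product\<close>

lemma
  fixes a q :: complex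
  assumes q: "norm q < 1"
  shows tendsto_qpoch: "(\<lambda>n. qpoch a q n) \<longlonglongrightarrow> qpoch_inf a q"
    and qpoch_inf_nonzero: "norm a < 1 \<Longrightarrow> qpoch_inf a q \<noteq> 0"
proof -
  have "summable (\<lambda>m. norm a * norm q ^ m)"
    using q by (intro summable_mult summable_geometric) simp
  hence "summable (\<lambda>m. norm ((1 - a * q ^ m) - 1))" by (simp add: norm_mult norm_power)
  hence conv: "convergent_prod (\<lambda>m. 1 - a * q ^ m)"
    by (intro abs_convergent_prod_imp_convergent_prod) (simp add: abs_convergent_prod_conv_summable)
  from convergent_prod_LIMSEQ[OF this] show "(\<lambda>n. qpoch a q n) \<longlonglongrightarrow> qpoch_inf a q"
    unfolding qpoch_def qpoch_inf_def by (simp add: LIMSEQ_lessThan_iff_atMost)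
  show "qpoch_inf a q \<noteq> 0" if "norm a < 1"
    unfolding qpoch_inf_def using conv one_minus_mult_power_nonzero[OF that] q
    by (intro prodinf_nonzero) auto
qed

lemma inverse_qpoch_bounded:
  fixes a q :: complex
  assumes "norm a < 1" "norm q < 1"
  obtains C where "C \<ge> 1" "\<And>n. norm (1 / qpoch a q n) \<le> C"
proof -
  have "(\<lambda>n. 1 / qpoch a q n) \<longlonglongrightarrow> 1 / qpoch_inf a q"
    using assms by (intro tendsto_intros tendsto_qpoch qpoch_inf_nonzero)
  hence "Bseq (\<lambda>n. 1 / qpoch a q n)" by (intro convergent_imp_Bseq convergentI)
  then obtain K where "\<And>n. norm (1 / qpoch a q n) \<le> K" by (auto elim!: BseqE)
  hence "\<And>n. norm (1 / qpoch a q n) \<le> max 1 K" by (meson max.coboundedI2)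
  thus ?thesis by (rule that[rotated]) simp
qed

lemma inv_qfact_bounded:
  assumes "norm q < 1"
  obtains C where "C \<ge> 1" "\<And>m. norm (inv_qfact q m) \<le> C"
proof -
  obtain C where "C \<ge> 1" "\<And>n. norm (1 / qpoch q q n) \<le> C"
    using inverse_qpoch_bounded[OF assms assms] by blast
  thus ?thesis by (intro that[of C]) (auto simp: inv_qfact_def)
qed

lemma tendsto_inv_qfact:
  assumes q: "norm q < 1"
  shows "(\<lambda>N. inv_qfact q (int N + r)) \<longlonglongrightarrow> 1 / qpoch_inf q q"
proof -
  have "(\<lambda>n. 1 / qpoch q q n) \<longlonglongrightarrow> 1 / qpoch_inf q q"
    using q by (intro tendsto_intros tendsto_qpoch qpoch_inf_nonzero)
  moreover have "filterlim (\<lambda>N. nat (int N + r)) sequentially sequentially"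
    unfolding filterlim_at_top eventually_sequentially
  proof
    fix Z
    have "Z \<le> nat (int N + r)" if "nat (int Z - r) \<le> N" for N using that by linarith
    thus "\<exists>K. \<forall>N\<ge>K. Z \<le> nat (int N + r)" by blast
  qed
  ultimately have "(\<lambda>N. 1 / qpoch q q (nat (int N + r))) \<longlonglongrightarrow> 1 / qpoch_inf q q"
    by (rule filterlim_compose)
  moreover have "eventually (\<lambda>N. 1 / qpoch q q (nat (int N + r)) = inv_qfact q (int N + r)) sequentially"
    using eventually_ge_at_top[of "nat (- r)"] by eventually_elim (auto simp: inv_qfact_def)
  ultimately show ?thesis by (rule Lim_transform_eventually)
qed

text \<open>
  Dominated convergence for sums over an arbitrary index set, obtained from the counting
  measure.
\<close>
lemma tendsto_infsum_dominated:
  fixes f :: "nat \<Rightarrow> 'a \<Rightarrow> complex"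
  assumes g: "g summable_on A" and bound: "\<And>n x. x \<in> A \<Longrightarrow> norm (f n x) \<le> g x"
    and lim: "\<And>x. x \<in> A \<Longrightarrow> (\<lambda>n. f n x) \<longlonglongrightarrow> h x"
  shows "(\<lambda>n. infsum (f n) A) \<longlonglongrightarrow> infsum h A"
proof -
  have hb: "norm (h x) \<le> g x" if "x \<in> A" for x
    using tendsto_norm[OF lim[OF that]] bound[OF that] by (intro Lim_bounded) auto
  have gi: "integrable (count_space A) g"
  proof -
    have "(\<lambda>x. norm (g x)) summable_on A"
      using g by (subst (asm) summable_on_iff_abs_summable_on_real)
    thus ?thesis by (simp only: abs_summable_equivalent abs_summable_on_def)
  qed
  have "(\<lambda>n. integral\<^sup>L (count_space A) (f n)) \<longlonglongrightarrow> integral\<^sup>L (count_space A) h"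
    by (rule integral_dominated_convergence[where w = g])
      (use gi bound lim in \<open>auto simp: AE_count_space\<close>)
  moreover have "integral\<^sup>L (count_space A) u = infsum u A" if "\<And>x. x \<in> A \<Longrightarrow> norm (u x) \<le> g x" for u :: "'a \<Rightarrow> complex"
  proof -
    have "(\<lambda>x. norm (u x)) summable_on A"
      using g that by (rule Infinite_Sum.abs_summable_on_comparison_test')
    hence "Infinite_Set_Sum.abs_summable_on u A" by (simp only: abs_summable_equivalent)
    from infsetsum_infsum[OF this] show ?thesis by (simp add: infsetsum_def)
  qed
  ultimately show ?thesis using bound hb by simp
qed

lemma tendsto_bailey_sum:
  assumes q: "norm q < 1" and f: "(\<lambda>r. norm (f r)) summable_on UNIV"
  shows "bailey_sum q 0 f \<longlonglongrightarrow> (\<Sum>\<^sub>\<infinity>r. f r) / (qpoch_inf q q)\<^sup>2"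
proof -
  obtain C where C: "C \<ge> 1" "\<And>m. norm (inv_qfact q m) \<le> C" using inv_qfact_bounded[OF q] by blast
  have "(\<lambda>N. \<Sum>\<^sub>\<infinity>r. f r * bailey_kernel q 0 N r) \<longlonglongrightarrow> (\<Sum>\<^sub>\<infinity>r. f r * (1 / (qpoch_inf q q)\<^sup>2))"
  proof (rule tendsto_infsum_dominated)
    show "(\<lambda>r. norm (f r) * (C * C)) summable_on UNIV" using f by (rule summable_on_cmult_left)
    show "norm (f r * bailey_kernel q 0 N r) \<le> norm (f r) * (C * C)" for N r
      unfolding norm_mult bailey_kernel_def using C by (intro mult_left_mono mult_mono) auto
    show "(\<lambda>N. f r * bailey_kernel q 0 N r) \<longlonglongrightarrow> f r * (1 / (qpoch_inf q q)\<^sup>2)" for r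
    proof -
      have "(\<lambda>N. f r * (inv_qfact q (int N + - r) * inv_qfact q (int N + r)))
          \<longlonglongrightarrow> f r * (1 / qpoch_inf q q * (1 / qpoch_inf q q))"
        using q by (intro tendsto_intros tendsto_inv_qfact)
      thus ?thesis by (simp add: bailey_kernel_def power2_eq_square)
    qed
  qed
  moreover have "f summable_on UNIV" using f by (rule abs_summable_summable)
  ultimately show ?thesis unfolding bailey_sum_def by (subst (asm) infsum_cmult_left) auto
qed

lemma tendsto_convolution_inv_qfact:
  assumes q: "norm q < 1" and g: "g summable_on (UNIV :: nat set)"
  shows "(\<lambda>N. \<Sum>M\<le>N. inv_qfact q (int N - int M) * g M) \<longlonglongrightarrow> (\<Sum>\<^sub>\<infinity>M. g M) / qpoch_inf q q"
proof -
  obtain C where C: "C \<ge> 1" "\<And>m. norm (inv_qfact q m) \<le> C" using inv_qfact_bounded[OF q] by blast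
  have "(\<lambda>N. \<Sum>\<^sub>\<infinity>M. inv_qfact q (int N - int M) * g M) \<longlonglongrightarrow> (\<Sum>\<^sub>\<infinity>M. 1 / qpoch_inf q q * g M)"
  proof (rule tendsto_infsum_dominated)
    show "(\<lambda>M. C * norm (g M)) summable_on UNIV"
      using g by (intro summable_on_cmult_right) (simp only: summable_on_iff_abs_summable_on_complex)
    show "norm (inv_qfact q (int N - int M) * g M) \<le> C * norm (g M)" for N M
      unfolding norm_mult using C by (intro mult_right_mono) auto
    show "(\<lambda>N. inv_qfact q (int N - int M) * g M) \<longlonglongrightarrow> 1 / qpoch_inf q q * g M" for M
      using tendsto_inv_qfact[OF q, of "- int M"] by (intro tendsto_intros) simp
  qed
  moreover have "(\<Sum>\<^sub>\<infinity>M. inv_qfact q (int N - int M) * g M) = (\<Sum>M\<le>N. inv_qfact q (int N - int M) * g M)" for N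
  proof -
    have "(\<Sum>\<^sub>\<infinity>M. inv_qfact q (int N - int M) * g M) = (\<Sum>\<^sub>\<infinity>M\<in>{..N}. inv_qfact q (int N - int M) * g M)"
      by (rule infsum_cong_neutral) auto
    thus ?thesis by simp
  qed
  moreover have "(\<Sum>\<^sub>\<infinity>M. 1 / qpoch_inf q q * g M) = 1 / qpoch_inf q q * (\<Sum>\<^sub>\<infinity>M. g M)"
    using g by (intro infsum_cmult_right)
  ultimately show ?thesis by simp
qed

lemma summable_power_abs_int:
  fixes c :: real
  assumes "0 \<le> c" "c < 1"
  shows "(\<lambda>r::int. c ^ nat \<bar>r\<bar>) summable_on UNIV"
proof -
  have nat: "(\<lambda>n. c ^ n) summable_on UNIV"
    using assms by (intro summable_nonneg_imp_summable_on summable_geometric) auto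
  have "(\<lambda>r::int. c ^ nat \<bar>r\<bar>) summable_on range int"
    using nat by (subst summable_on_reindex) (auto simp: o_def)
  moreover have "(\<lambda>r::int. c ^ nat \<bar>r\<bar>) summable_on range (\<lambda>n. - int n)"
    using nat by (subst summable_on_reindex) (auto simp: o_def inj_on_def)
  moreover have "range int \<union> range (\<lambda>n. - int n) = UNIV"
  proof -
    have "r \<in> range int \<union> range (\<lambda>n. - int n)" for r by (cases r rule: int_cases2) auto
    thus ?thesis by blast
  qed
  ultimately show ?thesis using summable_on_union by metis
qed

lemma theta_term_abs_summable:
  assumes "norm a < 1" "norm b < 1"
  shows "(\<lambda>r. norm (theta_term a b r)) summable_on UNIV"
proof (rule Infinite_Sum.abs_summable_on_comparison_test')
  define c where "c = max (norm a) (norm b)"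
  have c: "0 \<le> c" "c < 1" "norm a \<le> c" "norm b \<le> c" using assms by (auto simp: c_def le_max_iff_disj)
  show "(\<lambda>r::int. c ^ nat \<bar>r\<bar>) summable_on UNIV" using c by (intro summable_power_abs_int)
  show "norm (theta_term a b r) \<le> c ^ nat \<bar>r\<bar>" for r
  proof -
    have "norm (theta_term a b r) \<le> c ^ tri r * c ^ tri (r - 1)"
      unfolding theta_term_def norm_mult norm_power using c by (intro mult_mono power_mono) auto
    also have "\<dots> = c ^ nat (r * r)" by (simp only: tri_add_tri_diff_1 flip: power_add)
    also have "\<dots> \<le> c ^ nat \<bar>r\<bar>"
    proof (rule power_decreasing)
      have "\<bar>r\<bar> * 1 \<le> \<bar>r\<bar> * \<bar>r\<bar>" by (cases "r = 0") (simp, rule mult_left_mono, simp_all)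
      thus "nat \<bar>r\<bar> \<le> nat (r * r)" by (intro nat_mono) simp
    qed (use c in auto)
    finally show ?thesis .
  qed
qed

text \<open>
  Taking \<open>n\<close> to infinity in \<open>bailey_sum_theta_product\<close>: the sum on its left tends to the theta
  series divided by \<open>(w)\<^sub>\<infinity>\<^sup>2\<close>, and \<open>(w)\<^bsub>2n\<^esub>\<close> tends to \<open>(w)\<^sub>\<infinity>\<close>.
\<close>
theorem jacobi_triple_product:
  assumes a: "norm a < 1" and b: "norm b < 1"
  shows "(\<Sum>\<^sub>\<infinity>r. theta_term a b r)
    = qpoch_inf (- a) (a * b) * qpoch_inf (- b) (a * b) * qpoch_inf (a * b) (a * b)"
proof -
  let ?w = "a * b"
  have w: "norm ?w < 1"
    using mult_strict_mono'[of "norm a" 1 "norm b" 1] a b by (simp add: norm_mult)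
  have nz: "qpoch_inf ?w ?w \<noteq> 0" using w by (intro qpoch_inf_nonzero)
  have "(\<lambda>n. qpoch ?w ?w (2 * n)) \<longlonglongrightarrow> qpoch_inf ?w ?w"
    using LIMSEQ_subseq_LIMSEQ[OF tendsto_qpoch[OF w], of "\<lambda>n. 2 * n"]
    by (simp add: strict_mono_def o_def)
  hence "(\<lambda>n. bailey_sum ?w 0 (theta_term a b) n * qpoch ?w ?w (2 * n))
      \<longlonglongrightarrow> (\<Sum>\<^sub>\<infinity>r. theta_term a b r) / (qpoch_inf ?w ?w)\<^sup>2 * qpoch_inf ?w ?w"
    using w a b by (intro tendsto_mult tendsto_bailey_sum theta_term_abs_summable)
  moreover have "(\<lambda>n. qpoch (- a) ?w n * qpoch (- b) ?w n)
      \<longlonglongrightarrow> qpoch_inf (- a) ?w * qpoch_inf (- b) ?w"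
    using w by (intro tendsto_mult tendsto_qpoch)
  ultimately have "(\<Sum>\<^sub>\<infinity>r. theta_term a b r) / (qpoch_inf ?w ?w)\<^sup>2 * qpoch_inf ?w ?w
      = qpoch_inf (- a) ?w * qpoch_inf (- b) ?w"
    unfolding bailey_sum_theta_product[OF w] by (rule LIMSEQ_unique)
  thus ?thesis using nz by (simp add: field_simps power2_eq_square)
qed

section \<open>Summing a multisum level by level\<close>

text \<open>
  The part of the summand that belongs to the levels \<open>j, \<dots>, k\<close>, with arbitrary weights \<open>u\<close>, \<open>v\<close>
  and \<open>\<beta>\<close>. A variable lower end \<open>j\<close> allows an induction that never renumbers the variables.
\<close>
definition chain_term ::
    "(nat \<Rightarrow> nat \<Rightarrow> complex) \<Rightarrow> (nat \<Rightarrow> complex) \<Rightarrow> (nat \<Rightarrow> complex) \<Rightarrow> nat \<Rightarrow> nat \<Rightarrow> (nat \<Rightarrow> nat) \<Rightarrow> complex" where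
  "chain_term u v \<beta> k j n =
     (\<Prod>l=j..k. u l (tail_sum k n l)) * (\<Prod>l=j..<k. v (n l)) * \<beta> (n k)"

definition tuples_with_sum :: "nat \<Rightarrow> nat \<Rightarrow> nat \<Rightarrow> (nat \<Rightarrow> nat) set" where
  "tuples_with_sum k j M = {n \<in> {j..k} \<rightarrow>\<^sub>E UNIV. tail_sum k n j = M}"

lemma tail_sum_cong: "(\<And>l. j \<le> l \<Longrightarrow> l \<le> k \<Longrightarrow> n l = n' l) \<Longrightarrow> tail_sum k n j = tail_sum k n' j"
  by (auto simp: tail_sum_def intro: sum.cong)

lemma tail_sum_rec: "j \<le> k \<Longrightarrow> tail_sum k n j = n j + tail_sum k n (Suc j)"
  by (simp add: tail_sum_def sum.atLeast_Suc_atMost)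

lemma le_tail_sum: "j \<le> l \<Longrightarrow> l \<le> k \<Longrightarrow> n l \<le> tail_sum k n j"
  unfolding tail_sum_def by (intro member_le_sum) auto

lemma finite_tuples_with_sum: "finite (tuples_with_sum k j M)"
proof (rule finite_subset)
  show "tuples_with_sum k j M \<subseteq> {j..k} \<rightarrow>\<^sub>E {..M}"
  proof
    fix n assume "n \<in> tuples_with_sum k j M"
    thus "n \<in> {j..k} \<rightarrow>\<^sub>E {..M}"
      using le_tail_sum[of j _ k n] by (auto simp: tuples_with_sum_def PiE_iff)
  qed
qed (intro finite_PiE, auto)

lemma chain_term_rec:
  assumes "j < k" "\<And>l. Suc j \<le> l \<Longrightarrow> l \<le> k \<Longrightarrow> n l = n' l"
  shows "chain_term u v \<beta> k j n = u j (tail_sum k n j) * (v (n j) * chain_term u v \<beta> k (Suc j) n')"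
proof -
  have "(\<Prod>l=Suc j..k. u l (tail_sum k n l)) = (\<Prod>l=Suc j..k. u l (tail_sum k n' l))"
    by (intro prod.cong refl arg_cong2[where f = u] tail_sum_cong) (auto intro: assms(2))
  moreover have "(\<Prod>l=Suc j..<k. v (n l)) = (\<Prod>l=Suc j..<k. v (n' l))"
    by (intro prod.cong refl arg_cong[where f = v]) (auto intro: assms(2))
  moreover have "n k = n' k" using assms by simp
  ultimately show ?thesis
    using assms(1) unfolding chain_term_def
    by (simp add: prod.atLeast_Suc_atMost prod.atLeast_Suc_lessThan mult_ac)
qed

text \<open>
  A tuple \<open>(n j, \<dots>, n k)\<close> of total \<open>M\<close> is a tuple \<open>(n (j + 1), \<dots>, n k)\<close> of some total
  \<open>M' \<le> M\<close> together with \<open>n j = M - M'\<close>.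
\<close>
lemma sum_chain_term_rec:
  assumes "j < k"
  shows "(\<Sum>n\<in>tuples_with_sum k j M. chain_term u v \<beta> k j n)
    = u j M * (\<Sum>M'\<le>M. v (M - M') * (\<Sum>n\<in>tuples_with_sum k (Suc j) M'. chain_term u v \<beta> k (Suc j) n))"
proof -
  let ?T = "tuples_with_sum k"
  let ?cut = "\<lambda>n. (tail_sum k n (Suc j), restrict n {Suc j..k})"
  let ?glue = "\<lambda>(M', n). n(j := M - M')"
  have "(\<Sum>M'\<le>M. v (M - M') * (\<Sum>n\<in>?T (Suc j) M'. chain_term u v \<beta> k (Suc j) n))
      = (\<Sum>(M', n)\<in>Sigma {..M} (?T (Suc j)). v (M - M') * chain_term u v \<beta> k (Suc j) n)"
    unfolding sum_distrib_left
    by (subst sum.Sigma) (auto simp: finite_tuples_with_sum)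
  hence "u j M * (\<Sum>M'\<le>M. v (M - M') * (\<Sum>n\<in>?T (Suc j) M'. chain_term u v \<beta> k (Suc j) n))
      = (\<Sum>(M', n)\<in>Sigma {..M} (?T (Suc j)). u j M * (v (M - M') * chain_term u v \<beta> k (Suc j) n))"
    by (simp add: sum_distrib_left case_prod_unfold)
  also have "\<dots> = (\<Sum>n\<in>?T j M. chain_term u v \<beta> k j n)"
  proof (rule sum.reindex_bij_witness[of _ ?cut ?glue])
    fix a assume "a \<in> Sigma {..M} (?T (Suc j))"
    then obtain M' n where a: "a = (M', n)" and M': "M' \<le> M" and n: "n \<in> ?T (Suc j) M'" by blast
    have ext: "n l = undefined" if "l \<notin> {Suc j..k}" for l
      using n that PiE_arb[of n "{Suc j..k}" "\<lambda>_. UNIV" l] by (simp add: tuples_with_sum_def)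
    have t: "tail_sum k (n(j := M - M')) (Suc j) = M'"
      using n tail_sum_cong[of "Suc j" k "n(j := M - M')" n] by (simp add: tuples_with_sum_def)
    have tj: "tail_sum k (n(j := M - M')) j = M"
      using tail_sum_rec[of j k "n(j := M - M')"] assms t M' by simp
    have "restrict (n(j := M - M')) {Suc j..k} = n"
    proof
      fix l show "restrict (n(j := M - M')) {Suc j..k} l = n l" using ext[of l] by (cases "l = j") auto
    qed
    thus "?cut (?glue a) = a" unfolding a using t by simp
    have "n(j := M - M') \<in> {j..k} \<rightarrow>\<^sub>E UNIV"
    proof (rule PiE_I)
      fix l assume "l \<notin> {j..k}"
      thus "(n(j := M - M')) l = undefined" using ext[of l] assms by auto
    qed simp
    thus "?glue a \<in> ?T j M" unfolding a using tj by (simp add: tuples_with_sum_def)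
    show "chain_term u v \<beta> k j (?glue a)
        = (case a of (M', n) \<Rightarrow> u j M * (v (M - M') * chain_term u v \<beta> k (Suc j) n))"
      using chain_term_rec[OF assms, of "n(j := M - M')" n u v \<beta>] tj by (simp add: a)
  next
    fix n assume n: "n \<in> ?T j M"
    have ext: "n l = undefined" if "l \<notin> {j..k}" for l
      using n that PiE_arb[of n "{j..k}" "\<lambda>_. UNIV" l] by (simp add: tuples_with_sum_def)
    have t: "n j + tail_sum k n (Suc j) = M"
      using n tail_sum_rec[of j k n] assms by (simp add: tuples_with_sum_def)
    have "(restrict n {Suc j..k})(j := M - tail_sum k n (Suc j)) = n"
    proof
      fix l show "((restrict n {Suc j..k})(j := M - tail_sum k n (Suc j))) l = n l"
        using ext[of l] t by (cases "l = j") auto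
    qed
    thus "?glue (?cut n) = n" by simp
    have "tail_sum k (restrict n {Suc j..k}) (Suc j) = tail_sum k n (Suc j)"
      by (rule tail_sum_cong) simp
    thus "?cut n \<in> Sigma {..M} (?T (Suc j))"
      using t by (simp add: tuples_with_sum_def)
  qed
  finally show ?thesis ..
qed

lemma sum_chain_term_last:
  "(\<Sum>n\<in>tuples_with_sum k k M. chain_term u v \<beta> k k n) = u k M * \<beta> M"
proof -
  have "tuples_with_sum k k M = {(\<lambda>l\<in>{k}. M)}"
  proof (intro equalityI subsetI)
    fix n assume n: "n \<in> tuples_with_sum k k M"
    have "n = (\<lambda>l\<in>{k}. n k)"
    proof
      fix l show "n l = (\<lambda>l\<in>{k}. n k) l"
        using n PiE_arb[of n "{k..k}" "\<lambda>_. UNIV" l] by (cases "l = k") (auto simp: tuples_with_sum_def)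
    qed
    moreover have "n k = M" using n by (simp add: tuples_with_sum_def tail_sum_def)
    ultimately show "n \<in> {(\<lambda>l\<in>{k}. M)}" by simp
  qed (simp add: tuples_with_sum_def tail_sum_def)
  thus ?thesis by (simp add: chain_term_def tail_sum_def)
qed

section \<open>Climbing the chain\<close>

lemma theta_term_mult_square:
  "q ^ nat (r * r + int 0 * r) * theta_term a b r = theta_term (a * q) (b * q) r"
proof -
  have "nat (r * r + int 0 * r) = tri r + tri (r - 1)" by (simp add: tri_add_tri_diff_1)
  thus ?thesis by (simp only: theta_term_def power_mult_distrib power_add mult_ac)
qed

lemma theta_term_mult_pronic:
  "q ^ nat (r * r + int 1 * r) * theta_term a b r = theta_term (a * q\<^sup>2) b r"
proof -
  have "nat (r * r + int 1 * r) = 2 * tri r" using double_tri[of r] by (simp add: algebra_simps)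
  hence "q ^ nat (r * r + int 1 * r) = (q\<^sup>2) ^ tri r" by (simp only: power_mult)
  thus ?thesis by (simp only: theta_term_def power_mult_distrib mult_ac)
qed

text \<open>
  The number of levels among \<open>j, \<dots>, k\<close> whose weight contains a linear term.
\<close>
definition linear_levels :: "nat \<Rightarrow> nat \<Rightarrow> nat \<Rightarrow> nat" where
  "linear_levels k i j = k + 1 - max i j"

text \<open>
  The coefficients reached once the levels \<open>j, \<dots>, k\<close> have been summed. Of these
  \<open>p = k + 1 - j\<close> levels, \<open>m = linear_levels k i j\<close> multiply \<open>(a, b)\<close> by \<open>(s\<^sup>4, 1)\<close> and the others
  multiply it by \<open>(s\<^sup>2, s\<^sup>2)\<close>. Starting from \<open>(-s, -s\<^sup>2)\<close> this gives the exponents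
  \<open>1 + 2p + 2m\<close> and \<open>2 + 2p - 2m\<close>.
\<close>
definition level_theta :: "complex \<Rightarrow> nat \<Rightarrow> nat \<Rightarrow> nat \<Rightarrow> int \<Rightarrow> complex" where
  "level_theta s k i j = theta_term
     (- (s ^ (1 + 2 * (k + 1 - j) + 2 * linear_levels k i j)))
     (- (s ^ (2 + 2 * (k + 1 - j) - 2 * linear_levels k i j)))"

definition level_weight :: "complex \<Rightarrow> nat \<Rightarrow> nat \<Rightarrow> nat \<Rightarrow> complex" where
  "level_weight q i l M = q ^ (M\<^sup>2 + (if i \<le> l then M else 0))"

text \<open>
  For \<open>i \<le> j\<close> the second parameter is \<open>-s\<^sup>2 = -q\<close> before and after the step, so the step with
  \<open>d = 1\<close> can be both entered and left through \<open>bailey_sum_theta_0_eq_1\<close>. For \<open>j < i\<close> the step has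
  \<open>d = 0\<close> and needs no conversion.
\<close>
lemma level_step:
  assumes s: "norm (s\<^sup>2) < 1" and j: "j \<le> k" and i: "i \<le> k + 1"
  shows "(\<Sum>M\<le>N. inv_qfact (s\<^sup>2) (int N - int M) *
            (level_weight (s\<^sup>2) i j M * bailey_sum (s\<^sup>2) 0 (level_theta s k i (Suc j)) M))
    = bailey_sum (s\<^sup>2) 0 (level_theta s k i j) N"
proof (cases "i \<le> j")
  case True
  define p where "p = k - j"
  have k: "k = j + p" using j by (simp add: p_def)
  have old: "level_theta s k i (Suc j) = theta_term (- (s ^ (1 + 4 * p))) (- (s\<^sup>2))"
    using True by (simp add: level_theta_def linear_levels_def k)
  have new: "level_theta s k i j = theta_term (- (s ^ (1 + 4 * Suc p))) (- (s\<^sup>2))"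
  proof -
    have "linear_levels k i j = k + 1 - j" using True by (simp add: linear_levels_def)
    moreover have "1 + 2 * (k + 1 - j) + 2 * (k + 1 - j) = 1 + 4 * Suc p"
      "2 + 2 * (k + 1 - j) - 2 * (k + 1 - j) = 2" by (simp_all add: k)
    ultimately show ?thesis by (simp only: level_theta_def)
  qed
  have "(\<Sum>M\<le>N. inv_qfact (s\<^sup>2) (int N - int M) *
            (level_weight (s\<^sup>2) i j M * bailey_sum (s\<^sup>2) 0 (level_theta s k i (Suc j)) M))
     = (\<Sum>M\<le>N. (s\<^sup>2) ^ (M * M + 1 * M) * inv_qfact (s\<^sup>2) (int N - int M)
            * bailey_sum (s\<^sup>2) 1 (level_theta s k i (Suc j)) M)"
    using True unfolding old bailey_sum_theta_0_eq_1[OF s]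
    by (intro sum.cong refl) (simp add: level_weight_def power2_eq_square mult_ac)
  also have "\<dots> = bailey_sum (s\<^sup>2) 1 (level_theta s k i j) N"
  proof -
    have "- (s ^ (1 + 4 * p)) * (s\<^sup>2)\<^sup>2 = - (s ^ (1 + 4 * Suc p))"
    proof -
      have "1 + 4 * Suc p = (1 + 4 * p) + 2 * 2" by simp
      thus ?thesis by (simp only: power_add[of s "1 + 4 * p" "2 * 2"] power_mult[of s 2 2] mult_minus_left)
    qed
    thus ?thesis unfolding bailey_sum_step[OF s order.refl] old new theta_term_mult_pronic by (simp only:)
  qed
  also have "\<dots> = bailey_sum (s\<^sup>2) 0 (level_theta s k i j) N"
    unfolding new by (rule bailey_sum_theta_0_eq_1[OF s, symmetric])
  finally show ?thesis .
next
  case False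
  define p where "p = k - j"
  have k: "k = j + p" using j by (simp add: p_def)
  define m where "m = linear_levels k i j"
  have m: "linear_levels k i (Suc j) = m" "m \<le> p"
    using False i by (auto simp: m_def linear_levels_def k)
  have old: "level_theta s k i (Suc j) = theta_term (- (s ^ (1 + 2 * p + 2 * m))) (- (s ^ (2 + 2 * p - 2 * m)))"
    unfolding level_theta_def m by (simp add: k)
  have new: "level_theta s k i j = theta_term (- (s ^ (1 + 2 * p + 2 * m) * s\<^sup>2)) (- (s ^ (2 + 2 * p - 2 * m) * s\<^sup>2))"
  proof -
    have "1 + 2 * (k + 1 - j) + 2 * m = 1 + 2 * p + 2 * m + 2"
      "2 + 2 * (k + 1 - j) - 2 * m = 2 + 2 * p - 2 * m + 2"
      using m(2) by (simp_all add: k)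
    thus ?thesis unfolding level_theta_def m_def[symmetric] by (simp only: power_add)
  qed
  have "(\<Sum>M\<le>N. inv_qfact (s\<^sup>2) (int N - int M) *
            (level_weight (s\<^sup>2) i j M * bailey_sum (s\<^sup>2) 0 (level_theta s k i (Suc j)) M))
     = (\<Sum>M\<le>N. (s\<^sup>2) ^ (M * M + 0 * M) * inv_qfact (s\<^sup>2) (int N - int M)
            * bailey_sum (s\<^sup>2) 0 (level_theta s k i (Suc j)) M)"
    using False by (intro sum.cong refl) (simp add: level_weight_def power2_eq_square mult_ac)
  also have "\<dots> = bailey_sum (s\<^sup>2) 0 (level_theta s k i j) N"
    unfolding bailey_sum_step[OF s zero_le_one] old new theta_term_mult_square by simp
  finally show ?thesis .
qed

definition seed :: "complex \<Rightarrow> nat \<Rightarrow> complex" where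
  "seed s M = 1 / (qpoch (- s) (s\<^sup>2) M * qpoch ((s\<^sup>2)\<^sup>2) ((s\<^sup>2)\<^sup>2) M)"

lemma seed_eq:
  assumes s: "norm (s\<^sup>2) < 1" and i: "i \<le> k + 1"
  shows "seed s M = bailey_sum (s\<^sup>2) 0 (level_theta s k i (Suc k)) M"
  using bailey_sum_theta_seed[OF s] i by (simp add: seed_def level_theta_def linear_levels_def)

lemma level_sum:
  assumes s: "norm (s\<^sup>2) < 1" and i: "i \<le> k + 1" and j: "j \<le> k"
  shows "(\<Sum>n\<in>tuples_with_sum k j M.
       chain_term (level_weight (s\<^sup>2) i) (\<lambda>m. inv_qfact (s\<^sup>2) (int m)) (seed s) k j n)
    = level_weight (s\<^sup>2) i j M * bailey_sum (s\<^sup>2) 0 (level_theta s k i (Suc j)) M"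
  using j
proof (induction j arbitrary: M rule: inc_induct)
  case base
  show ?case unfolding sum_chain_term_last seed_eq[OF s i] ..
next
  case (step j)
  have "int (M - M') = int M - int M'" if "M' \<le> M" for M' using that by simp
  hence "(\<Sum>M'\<le>M. inv_qfact (s\<^sup>2) (int (M - M')) * (level_weight (s\<^sup>2) i (Suc j) M' *
        bailey_sum (s\<^sup>2) 0 (level_theta s k i (Suc (Suc j))) M'))
      = bailey_sum (s\<^sup>2) 0 (level_theta s k i (Suc j)) M"
    using step.hyps by (subst level_step[OF s _ i, symmetric]) auto
  thus ?case unfolding sum_chain_term_rec[OF step.hyps(2)] step.IH by simp
qed

lemma multisum_term_eq_chain_term:
  assumes k: "k \<ge> 1" and i: "i \<ge> 1"
  shows "multisum_term (s\<^sup>2) s k i n =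
    chain_term (level_weight (s\<^sup>2) i) (\<lambda>m. inv_qfact (s\<^sup>2) (int m)) (seed s) k 1 n"
proof -
  have "(\<Sum>j=i..k. tail_sum k n j) = (\<Sum>j=1..k. if i \<le> j then tail_sum k n j else 0)"
    using i by (intro sum.mono_neutral_cong_left) auto
  hence "(s\<^sup>2) ^ ((\<Sum>j=1..k. (tail_sum k n j)\<^sup>2) + (\<Sum>j=i..k. tail_sum k n j))
    = (\<Prod>j=1..k. level_weight (s\<^sup>2) i j (tail_sum k n j))"
    by (simp only: level_weight_def power_sum flip: sum.distrib)
  moreover have "(\<Prod>j=1..<k. inv_qfact (s\<^sup>2) (int (n j))) = 1 / (\<Prod>j=1..<k. qpoch (s\<^sup>2) (s\<^sup>2) (n j))"
    by (simp add: inv_qfact_of_nat prod_dividef)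
  ultimately show ?thesis
    unfolding multisum_term_def chain_term_def seed_def by simp
qed

section \<open>Absolute convergence and the identity\<close>

text \<open>
  Since \<open>N\<^sub>l\<^sup>2 \<ge> N\<^sub>l \<ge> n\<^sub>l\<close>, the weights are dominated by a product of geometric terms in the
  separate variables \<open>n\<^sub>l\<close>, which is summable over all tuples.
\<close>
lemma norm_chain_term_le:
  assumes q: "norm q < 1" and \<beta>: "\<And>m. norm (\<beta> m) \<le> B" and v: "\<And>m. norm (v m) \<le> C"
  shows "norm (chain_term (level_weight q i) v \<beta> k 1 n) \<le> (\<Prod>l=1..k. norm q ^ n l) * C ^ (k - 1) * B"
proof -
  have B: "B \<ge> 0" using norm_ge_zero \<beta> order_trans by blast
  have C: "C \<ge> 0" using norm_ge_zero v order_trans by blast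
  have "(\<Prod>l=1..k. norm (level_weight q i l (tail_sum k n l))) \<le> (\<Prod>l=1..k. norm q ^ n l)"
  proof (rule prod_mono, intro conjI)
    fix l assume l: "l \<in> {1..k}"
    have "n l \<le> tail_sum k n l" using l by (intro le_tail_sum) auto
    also have "\<dots> \<le> (tail_sum k n l)\<^sup>2" by (simp add: power2_nat_le_imp_le power2_eq_square)
    finally show "norm (level_weight q i l (tail_sum k n l)) \<le> norm q ^ n l"
      unfolding level_weight_def norm_power using q by (intro power_decreasing) auto
  qed simp
  moreover have "(\<Prod>l=1..<k. norm (v (n l))) \<le> (\<Prod>l=1..<k. C)"
    using v by (intro prod_mono) auto
  ultimately show ?thesis
    unfolding chain_term_def norm_mult prod_norm[symmetric] using \<beta> B C
    by (intro mult_mono) (auto intro!: prod_nonneg mult_nonneg_nonneg)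
qed

lemma seed_bounded:
  assumes s: "norm s < 1"
  obtains B where "\<And>M. norm (seed s M) \<le> B"
proof -
  have q: "norm (s\<^sup>2) < 1" "norm ((s\<^sup>2)\<^sup>2) < 1"
    using s by (simp_all add: norm_power power_less_one_iff)
  obtain C where C: "C \<ge> 1" "\<And>n. norm (1 / qpoch (- s) (s\<^sup>2) n) \<le> C"
    using inverse_qpoch_bounded[of "- s" "s\<^sup>2"] s q by auto
  obtain D where D: "D \<ge> 1" "\<And>n. norm (1 / qpoch ((s\<^sup>2)\<^sup>2) ((s\<^sup>2)\<^sup>2) n) \<le> D"
    using inverse_qpoch_bounded[of "(s\<^sup>2)\<^sup>2" "(s\<^sup>2)\<^sup>2"] q by auto
  have "norm (seed s M) \<le> C * D" for M
  proof -
    have "seed s M = 1 / qpoch (- s) (s\<^sup>2) M * (1 / qpoch ((s\<^sup>2)\<^sup>2) ((s\<^sup>2)\<^sup>2) M)"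
      by (simp add: seed_def)
    thus ?thesis using C D by (simp only: norm_mult) (intro mult_mono, auto)
  qed
  thus ?thesis by (rule that)
qed

lemma chain_term_summable:
  assumes s: "norm s < 1"
  shows "chain_term (level_weight (s\<^sup>2) i) (\<lambda>m. inv_qfact (s\<^sup>2) (int m)) (seed s) k 1
    summable_on ({1..k} \<rightarrow>\<^sub>E UNIV)"
proof -
  have q: "norm (s\<^sup>2) < 1" using s by (simp add: norm_power power_less_one_iff)
  obtain C where C: "\<And>m. norm (inv_qfact (s\<^sup>2) m) \<le> C" using inv_qfact_bounded[OF q] by blast
  obtain B where B: "\<And>M. norm (seed s M) \<le> B" using seed_bounded[OF s] by blast
  have "(\<lambda>m. norm (s\<^sup>2) ^ m) summable_on UNIV"
    using q by (intro summable_nonneg_imp_summable_on summable_geometric) auto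
  hence "Infinite_Set_Sum.abs_summable_on (\<lambda>m. norm (s\<^sup>2) ^ m) UNIV"
    unfolding abs_summable_equivalent[symmetric] by (simp add: norm_power)
  hence "Infinite_Set_Sum.abs_summable_on (\<lambda>n. \<Prod>l\<in>{1..k}. norm (s\<^sup>2) ^ n l) ({1..k} \<rightarrow>\<^sub>E UNIV)"
    by (intro abs_summable_on_prod_PiE) auto
  hence "(\<lambda>n. norm (\<Prod>l=1..k. norm (s\<^sup>2) ^ n l)) summable_on ({1..k} \<rightarrow>\<^sub>E UNIV)"
    by (simp only: abs_summable_equivalent)
  hence "(\<lambda>n. \<Prod>l=1..k. norm (s\<^sup>2) ^ n l) summable_on ({1..k} \<rightarrow>\<^sub>E UNIV)"
    by (rule abs_summable_summable)
  hence "(\<lambda>n. (\<Prod>l=1..k. norm (s\<^sup>2) ^ n l) * C ^ (k - 1) * B) summable_on ({1..k} \<rightarrow>\<^sub>E UNIV)"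
    by (intro summable_on_cmult_left)
  hence "(\<lambda>n. norm (chain_term (level_weight (s\<^sup>2) i) (\<lambda>m. inv_qfact (s\<^sup>2) (int m)) (seed s) k 1 n))
      summable_on ({1..k} \<rightarrow>\<^sub>E UNIV)"
    using norm_chain_term_le[of "s\<^sup>2" "seed s" B "\<lambda>m. inv_qfact (s\<^sup>2) (int m)" C i k] q B C
    by (intro Infinite_Sum.abs_summable_on_comparison_test') auto
  thus ?thesis by (rule abs_summable_summable)
qed

theorem theorem1p1:
  fixes q s :: complex and k i :: nat
  assumes "norm q < 1" and "s\<^sup>2 = q"
    and "1 \<le> k" and "1 \<le> i" and "i \<le> k + 1"
  shows "(multisum_term q s k i has_sum
      (qpoch_inf (q ^ i) (s ^ (3 + 4 * k))
       * qpoch_inf (s ^ (3 + 4 * k - 2 * i)) (s ^ (3 + 4 * k))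
       * qpoch_inf (s ^ (3 + 4 * k)) (s ^ (3 + 4 * k))
       / qpoch_inf q q))
     ({1..k} \<rightarrow>\<^sub>E UNIV)"
proof -
  have q: "norm (s\<^sup>2) < 1" and qs: "q = s\<^sup>2" using assms by simp_all
  have s: "norm s < 1" using q by (simp add: norm_power power_less_one_iff abs_square_less_1)
  let ?c = "chain_term (level_weight (s\<^sup>2) i) (\<lambda>m. inv_qfact (s\<^sup>2) (int m)) (seed s) k 1"
  let ?A = "{1..k} \<rightarrow>\<^sub>E UNIV :: (nat \<Rightarrow> nat) set"
  let ?g = "\<lambda>M. level_weight (s\<^sup>2) i 1 M * bailey_sum (s\<^sup>2) 0 (level_theta s k i (Suc 1)) M"
  have c: "(?c has_sum infsum ?c ?A) ?A" using chain_term_summable[OF s] by (rule has_sum_infsum)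
  \<comment> \<open>The tuples are grouped by their total \<open>N\<^sub>1 = M\<close>, which leaves finite inner sums.\<close>
  have "((\<lambda>x. ?c (snd x)) has_sum infsum ?c ?A) (Sigma UNIV (tuples_with_sum k 1))
      \<longleftrightarrow> (?c has_sum infsum ?c ?A) ?A"
    by (rule has_sum_reindex_bij_witness[where i = "\<lambda>n. (tail_sum k n 1, n)" and j = snd])
      (auto simp only: tuples_with_sum_def mem_Collect_eq mem_Sigma_iff UNIV_I snd_conv fst_conv prod.collapse)
  with c have "((\<lambda>x. ?c (snd x)) has_sum infsum ?c ?A) (Sigma UNIV (tuples_with_sum k 1))" by (simp only:)
  hence g: "(?g has_sum infsum ?c ?A) UNIV"
  proof (rule has_sum_SigmaD)
    show "((\<lambda>n. ?c (snd (M, n))) has_sum ?g M) (tuples_with_sum k 1 M)" for M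
      unfolding snd_conv using level_sum[OF q assms(5,3), of M]
      by (intro has_sum_finiteI finite_tuples_with_sum) (simp only:)
  qed
  \<comment> \<open>The convolution with \<open>1 / (q)\<^bsub>N-M\<^esub>\<close> lets the outermost level be treated like the others,
      at the price of one factor \<open>(q)\<^sub>\<infinity>\<close> in the limit.\<close>
  have "(\<lambda>N. \<Sum>M\<le>N. inv_qfact (s\<^sup>2) (int N - int M) * ?g M) \<longlonglongrightarrow> infsum ?c ?A / qpoch_inf (s\<^sup>2) (s\<^sup>2)"
    using tendsto_convolution_inv_qfact[OF q has_sum_imp_summable[OF g]] infsumI[OF g] by simp
  hence lim: "bailey_sum (s\<^sup>2) 0 (level_theta s k i 1) \<longlonglongrightarrow> infsum ?c ?A / qpoch_inf (s\<^sup>2) (s\<^sup>2)"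
    unfolding level_step[OF q assms(3,5)] .

  have "2 + 2 * (k + 1 - 1) - 2 * linear_levels k i 1 = 2 * i"
    "1 + 2 * (k + 1 - 1) + 2 * linear_levels k i 1 = 3 + 4 * k - 2 * i"
    using assms by (auto simp: linear_levels_def max_def)
  hence theta: "level_theta s k i 1 = theta_term (- (s ^ (3 + 4 * k - 2 * i))) (- (s ^ (2 * i)))"
    by (simp only: level_theta_def)
  have n1: "norm (- (s ^ (3 + 4 * k - 2 * i))) < 1" and n2: "norm (- (s ^ (2 * i))) < 1"
    using s assms by (simp_all add: norm_power power_less_one_iff)
  have prod: "- (s ^ (3 + 4 * k - 2 * i)) * - (s ^ (2 * i)) = s ^ (3 + 4 * k)"
    using assms by (simp flip: power_add)
  have pw: "s ^ (2 * i) = q ^ i" unfolding qs by (rule power_mult)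
  have "bailey_sum (s\<^sup>2) 0 (level_theta s k i 1) \<longlonglongrightarrow>
      (\<Sum>\<^sub>\<infinity>r. level_theta s k i 1 r) / (qpoch_inf (s\<^sup>2) (s\<^sup>2))\<^sup>2"
    using n1 n2 unfolding theta by (intro tendsto_bailey_sum q theta_term_abs_summable)
  hence "infsum ?c ?A / qpoch_inf (s\<^sup>2) (s\<^sup>2) = (\<Sum>\<^sub>\<infinity>r. level_theta s k i 1 r) / (qpoch_inf (s\<^sup>2) (s\<^sup>2))\<^sup>2"
    using lim by (intro LIMSEQ_unique)
  hence "infsum ?c ?A = (\<Sum>\<^sub>\<infinity>r. level_theta s k i 1 r) / qpoch_inf (s\<^sup>2) (s\<^sup>2)"
    using qpoch_inf_nonzero[OF q q] by (simp add: field_simps power2_eq_square)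
  also have "(\<Sum>\<^sub>\<infinity>r. level_theta s k i 1 r)
     = qpoch_inf (q ^ i) (s ^ (3 + 4 * k))
       * qpoch_inf (s ^ (3 + 4 * k - 2 * i)) (s ^ (3 + 4 * k))
       * qpoch_inf (s ^ (3 + 4 * k)) (s ^ (3 + 4 * k))"
    unfolding theta jacobi_triple_product[OF n1 n2] prod minus_minus
    unfolding pw by (simp only: mult_ac)
  finally show ?thesis
    using c unfolding qs multisum_term_eq_chain_term[OF assms(3,4)] by simp
qed

end
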